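(* Let $(a_0(n))_n$ and $(a_1(n))_n$ be real sequences with $2a_0(n)+a_1(n)=1$ for all $n$, and let $K_n^{M,1}$ be the associated modified Kantorovich operators. Suppose $f\in C^2[0,1]$ and that the (finite) limit $L_1=\lim_{n\to\infty}a_1(n)$ exists. For $x\in[0,1]$ put $X:=x(1-x)$ and $X':=1-2x$. Then for every $x\in[0,1]$ and every integer $n\ge1$, \begin{align*} &\left|n\left[K_n^{M,1}(f;x)-f(x)\right]-\frac X2f''(x)-\frac{X'}2(2+L_1)f'(x)\right|\\ &\le\frac{2}{3(n+1)}\left(\frac34\|f'\|_\infty+\|f''\|_\infty\right)+\frac9{32}\left\{\frac2{\sqrt{n+1}}\,\omega_1\!\left(f'';\frac1{\sqrt{n+1}}\right)+\omega_2\!\left(f'';\frac1{\sqrt{n+1}}\right)\right\}\\ &\quad+\frac12|L_1-a_1(n)|\,\|f'\|_\infty\\ &\quad+\frac12|L_1+1|\left\{\frac1{n+1}\|f'\|_\infty+\frac1{\sqrt{n+1}}\,\omega_1\!\left(f';\frac1{\sqrt{n+1}}\right)+\frac98\,\omega_2\!\left(f';\frac1{\sqrt{n+1}}\right)\right\}. \end{align*}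
   Context: Bernstein basis: $p_{n,k}(x)=\binom nk x^k(1-x)^{n-k}$ for $0\le k\le n$, $x\in[0,1]$ (with $0^0=1$), and $p_{n,k}=0$ if $k<0$ or $k>n$. Modified basis: given real sequences $a_0(n),a_1(n)$, put $a(x,n)=a_1(n)x+a_0(n)$ and, for $0\le k\le n$, $$p_{n,k}^{M,1}(x)=a(x,n)\,p_{n-1,k}(x)+a(1-x,n)\,p_{n-1,k-1}(x).$$ Modified Kantorovich operator: $K_n^{M,1}(f;x)=(n+1)\sum_{k=0}^n p_{n,k}^{M,1}(x)\int_{k/(n+1)}^{(k+1)/(n+1)}f(t)\,dt$. (No positivity is assumed.) Moduli, for $g\in C[0,1]$ and $\delta>0$: $\omega_1(g;\delta)=\sup\{|g(s)-g(t)|: s,t\in[0,1],\ |s-t|\le\delta\}$ and $\omega_2(g;\delta)=\sup\{|g(t-h)-2g(t)+g(t+h)|: 0\le h\le\delta,\ t\pm h\in[0,1]\}$. $\|\cdot\|_\infty$ is the sup norm on $[0,1]$. *)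

theory Defs
  imports "HOL-Analysis.Analysis"
begin

text \<open>
  The lower index is an integer, because the modified basis uses \<open>p n (k - 1)\<close> with \<open>k = 0\<close>,
  where the value must be \<open>0\<close>; truncated subtraction on \<^typ>\<open>nat\<close> would not give this.
\<close>

definition bernstein_basis :: "nat \<Rightarrow> int \<Rightarrow> real \<Rightarrow> real" where
  "bernstein_basis n k x = (if 0 \<le> k \<and> k \<le> int n then Bernstein n (nat k) x else 0)"

definition mod_coeff :: "(nat \<Rightarrow> real) \<Rightarrow> (nat \<Rightarrow> real) \<Rightarrow> real \<Rightarrow> nat \<Rightarrow> real" where
  "mod_coeff a0 a1 x n = a1 n * x + a0 n"

text \<open>Meaningful for \<open>n \<ge> 1\<close> only, because of \<open>n - 1\<close>.\<close>

definition mod_basis ::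
    "(nat \<Rightarrow> real) \<Rightarrow> (nat \<Rightarrow> real) \<Rightarrow> nat \<Rightarrow> nat \<Rightarrow> real \<Rightarrow> real" where
  "mod_basis a0 a1 n k x =
     mod_coeff a0 a1 x n * bernstein_basis (n - 1) (int k) x
     + mod_coeff a0 a1 (1 - x) n * bernstein_basis (n - 1) (int k - 1) x"

definition mod_kantorovich ::
    "(nat \<Rightarrow> real) \<Rightarrow> (nat \<Rightarrow> real) \<Rightarrow> nat \<Rightarrow> (real \<Rightarrow> real) \<Rightarrow> real \<Rightarrow> real" where
  "mod_kantorovich a0 a1 n f x =
     (real n + 1) * (\<Sum>k = 0..n. mod_basis a0 a1 n k x
        * integral {real k / (real n + 1) .. (real k + 1) / (real n + 1)} f)"

text \<open>
  The suprema below are taken in \<^typ>\<open>real\<close>; they are the intended ones for functions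
  continuous on \<open>{0..1}\<close> (nonempty bounded sets) and \<open>\<delta> > 0\<close>.
\<close>

definition modulus1 :: "(real \<Rightarrow> real) \<Rightarrow> real \<Rightarrow> real" where
  "modulus1 g \<delta> = Sup {\<bar>g s - g t\<bar> | s t. s \<in> {0..1} \<and> t \<in> {0..1} \<and> \<bar>s - t\<bar> \<le> \<delta>}"

definition modulus2 :: "(real \<Rightarrow> real) \<Rightarrow> real \<Rightarrow> real" where
  "modulus2 g \<delta> =
     Sup {\<bar>g (t - h) - 2 * g t + g (t + h)\<bar> | t h.
            0 \<le> h \<and> h \<le> \<delta> \<and> t - h \<in> {0..1} \<and> t + h \<in> {0..1}}"

definition sup_norm :: "(real \<Rightarrow> real) \<Rightarrow> real" where
  "sup_norm g = (SUP x\<in>{0..1}. \<bar>g x\<bar>)"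

end

theory Submission
  imports Defs
begin

text \<open>
  Write \<open>K\<close> for the classical Kantorovich operator and \<open>X' = 1 - 2 * x\<close>. Then
  \<open>n (K\<^sup>M f - f) = n (K f - f) + (a1 n + 1) / 2 * X' * (K f)'\<close>, so the error splits into the classical
  Voronovskaya error of \<open>K\<close> and the error of \<open>(K f)'\<close> against \<open>f'\<close>. Both are bounded from above
  (and, applied to \<open>- f\<close>, from below) by replacing \<open>f''\<close>, respectively \<open>f'\<close>, by a majorant
  \<open>g x + c (u - x) + w (1 + (u - x)\<^sup>2 / (2 h\<^sup>2))\<close> with \<open>\<bar>c\<bar> \<le> W / h\<close>, where \<open>W\<close> and \<open>w\<close> bound
  the first and second modulus of \<open>g\<close> at \<open>h\<close>: \<open>K\<close> is positive and \<open>(K f)'\<close> is monotone in \<open>f'\<close>, and on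
  polynomials both are given by central moments of the binomial distribution. The majorant gives the constant
  \<open>1 + 1 / 8 = 9 / 8\<close>, since the second moment is about \<open>x (1 - x) / n \<le> 1 / (4 n)\<close>.
\<close>

section \<open>Quadratic majorants from second differences\<close>

text \<open>
  Subtracting from the chord error the parabola with second difference \<open>- w\<close> at step \<open>h\<close>
  leaves a function that is discretely convex at step \<open>h\<close>, so its leftmost maximiser
  lies within \<open>h\<close> of an endpoint; reflecting that endpoint in the maximiser bounds the maximum by \<open>w\<close>.
\<close>

lemma chord_minus_le:
  fixes g :: "real \<Rightarrow> real"
  assumes cont: "continuous_on {a..b} g" and ab: "a < b" and h: "h > 0"
    and diff2: "\<And>t s. 0 \<le> s \<Longrightarrow> s \<le> h \<Longrightarrow> a \<le> t - s \<Longrightarrow> t + s \<le> b \<Longrightarrow>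
      g (t - s) - 2 * g t + g (t + s) \<le> w"
    and x: "x \<in> {a..b}"
  shows "((b - x) * g a + (x - a) * g b) / (b - a) - g x
    \<le> w * (1 + (x - a) * (b - x) / (2 * h\<^sup>2))"
proof -
  have w: "w \<ge> 0" using diff2[of 0 a] ab h by simp
  define m where "m = (g b - g a) / (b - a)"
  define \<phi> where "\<phi> u = g a + (u - a) * m - g u" for u
  define q where "q u = w * (u - a) * (b - u) / (2 * h\<^sup>2)" for u
  define \<psi> where "\<psi> u = \<phi> u - q u" for u
  have \<phi>_ab: "\<phi> a = 0" "\<phi> b = 0" using ab by (auto simp: \<phi>_def m_def)
  have \<psi>_ab: "\<psi> a = 0" "\<psi> b = 0" by (auto simp: \<psi>_def \<phi>_ab q_def)
  have diff2_\<psi>: "\<psi> (t - s) - 2 * \<psi> t + \<psi> (t + s) \<ge> w * (s\<^sup>2 / h\<^sup>2) - w"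
    if "0 \<le> s" "s \<le> h" "a \<le> t - s" "t + s \<le> b" for t s
  proof -
    have "q (t - s) - 2 * q t + q (t + s) = - (w * (s\<^sup>2 / h\<^sup>2))"
      using h unfolding q_def by (simp add: field_simps power2_eq_square)
    moreover have "\<phi> (t - s) - 2 * \<phi> t + \<phi> (t + s) = - (g (t - s) - 2 * g t + g (t + s))"
      unfolding \<phi>_def by (simp add: algebra_simps)
    ultimately show ?thesis using diff2[OF that] by (simp add: \<psi>_def)
  qed
  have cont\<psi>: "continuous_on {a..b} \<psi>"
    unfolding \<psi>_def \<phi>_def q_def using ab h by (intro continuous_intros cont) auto
  obtain p where p: "p \<in> {a..b}" and max: "\<And>u. u \<in> {a..b} \<Longrightarrow> \<psi> u \<le> \<psi> p"
    using continuous_attains_sup[OF _ _ cont\<psi>] ab by auto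
  \<comment> \<open>The leftmost maximiser makes \<open>\<psi> (v - h) < \<psi> v\<close> strict,
    and in case 3 this contradicts the discrete convexity at step h.\<close>
  define Z where "Z = {u \<in> {a..b}. \<psi> u = \<psi> p}"
  have "closed Z"
    unfolding Z_def using continuous_closed_preimage_constant[OF cont\<psi>] by auto
  moreover have "Z \<noteq> {}" "bdd_below Z" using p by (auto simp: Z_def intro!: bdd_belowI[of _ a])
  ultimately have infZ: "Inf Z \<in> Z" by (rule closed_contains_Inf[rotated 2])
  define v where "v = Inf Z"
  have v: "v \<in> {a..b}" "\<psi> v = \<psi> p" using infZ by (auto simp: v_def Z_def)
  have leftmost: "\<psi> u \<noteq> \<psi> p" if "u \<in> {a..b}" "u < v" for u
    using that \<open>bdd_below Z\<close> cInf_lower[of u Z] by (auto simp: v_def Z_def)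
  have "\<psi> v \<le> w"
  proof -
    \<comment> \<open>If an endpoint lies within h of v, the nearer one is reflected, so that its
      mirror image stays in [a,b].\<close>
    consider "v - a \<le> h" "v - a \<le> b - v" | "b - v \<le> h" "b - v \<le> v - a" | "v - a > h" "b - v > h"
      by linarith
    then show ?thesis
    proof cases
      case 1
      have "w * ((v - a)\<^sup>2 / h\<^sup>2) - w \<le> \<psi> a - 2 * \<psi> v + \<psi> (2 * v - a)"
        using diff2_\<psi>[of "v - a" v] 1 v by (simp add: algebra_simps)
      moreover have "w * ((v - a)\<^sup>2 / h\<^sup>2) \<ge> 0" using w by simp
      moreover have "\<psi> (2 * v - a) \<le> \<psi> v" using max[of "2 * v - a"] 1 v by auto
      ultimately show ?thesis using \<psi>_ab by linarith
    next
      case 2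
      have "w * ((b - v)\<^sup>2 / h\<^sup>2) - w \<le> \<psi> (2 * v - b) - 2 * \<psi> v + \<psi> b"
        using diff2_\<psi>[of "b - v" v] 2 v by (simp add: algebra_simps)
      moreover have "w * ((b - v)\<^sup>2 / h\<^sup>2) \<ge> 0" using w by simp
      moreover have "\<psi> (2 * v - b) \<le> \<psi> v" using max[of "2 * v - b"] 2 v by auto
      ultimately show ?thesis using \<psi>_ab by linarith
    next
      case 3
      have "0 \<le> \<psi> (v - h) - 2 * \<psi> v + \<psi> (v + h)"
        using diff2_\<psi>[of h v] 3 h by simp
      moreover have "\<psi> (v + h) \<le> \<psi> v" using max[of "v + h"] 3 v h by auto
      moreover have "\<psi> (v - h) < \<psi> v"
        using max[of "v - h"] leftmost[of "v - h"] 3 v h by fastforce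
      ultimately show ?thesis by linarith
    qed
  qed
  then have "\<psi> x \<le> w" using max[OF x] v by simp
  moreover have "((b - x) * g a + (x - a) * g b) / (b - a) = g a + (x - a) * m"
    using ab by (simp add: m_def field_simps)
  ultimately show ?thesis by (simp add: \<psi>_def \<phi>_def q_def distrib_left mult.assoc)
qed

text \<open>Here every step is admissible, so the quadratic term of \<open>chord_minus_le\<close> vanishes as \<open>h\<close> grows.\<close>

lemma chord_minus_le_const:
  fixes g :: "real \<Rightarrow> real"
  assumes cont: "continuous_on {a..b} g" and ab: "a < b"
    and diff2: "\<And>t s. 0 \<le> s \<Longrightarrow> a \<le> t - s \<Longrightarrow> t + s \<le> b \<Longrightarrow>
      g (t - s) - 2 * g t + g (t + s) \<le> w"
    and x: "x \<in> {a..b}"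
  shows "((b - x) * g a + (x - a) * g b) / (b - a) - g x \<le> w"
proof -
  define A where "A = w * ((x - a) * (b - x) / 2)"
  have bound: "((b - x) * g a + (x - a) * g b) / (b - a) - g x \<le> w + A * (inverse e)\<^sup>2" if "e > 0" for e
    using chord_minus_le[OF cont ab that diff2 x]
    by (simp add: A_def field_simps power2_eq_square)
  have "((\<lambda>e. w + A * (inverse e)\<^sup>2) \<longlongrightarrow> w + A * 0\<^sup>2) at_top"
    by (intro tendsto_intros tendsto_inverse_0_at_top filterlim_ident)
  then have "((\<lambda>e. w + A * (inverse e)\<^sup>2) \<longlongrightarrow> w) at_top" by simp
  then show ?thesis
    by (rule tendsto_lowerbound)
       (auto intro!: eventually_mono[OF eventually_gt_at_top[of 0]] bound)
qed

text \<open>W and w are arbitrary upper bounds for the two moduli at h, not the suprema. Such bounds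
  pass to every smaller step and to -g, and boundedness of the underlying sets is settled once, in
  \<open>moduli_le_modulus\<close>.\<close>

definition moduli_le :: "(real \<Rightarrow> real) \<Rightarrow> real \<Rightarrow> real \<Rightarrow> real \<Rightarrow> bool" where
  "moduli_le g h W w \<longleftrightarrow>
    (\<forall>s t. s \<in> {0..1} \<and> t \<in> {0..1} \<and> \<bar>s - t\<bar> \<le> h \<longrightarrow> \<bar>g s - g t\<bar> \<le> W) \<and>
    (\<forall>t s. 0 \<le> s \<and> s \<le> h \<and> 0 \<le> t - s \<and> t + s \<le> 1 \<longrightarrow> \<bar>g (t - s) - 2 * g t + g (t + s)\<bar> \<le> w)"

lemma moduli_leD1:
    "moduli_le g h W w \<Longrightarrow> s \<in> {0..1} \<Longrightarrow> t \<in> {0..1} \<Longrightarrow> \<bar>s - t\<bar> \<le> h \<Longrightarrow> \<bar>g s - g t\<bar> \<le> W"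
  and moduli_leD2:
    "moduli_le g h W w \<Longrightarrow> 0 \<le> s \<Longrightarrow> s \<le> h \<Longrightarrow> 0 \<le> t - s \<Longrightarrow> t + s \<le> 1 \<Longrightarrow>
      \<bar>g (t - s) - 2 * g t + g (t + s)\<bar> \<le> w"
  unfolding moduli_le_def by blast+

lemma moduli_le_nonneg:
  assumes "moduli_le g h W w" "h \<ge> 0"
  shows "W \<ge> 0" "w \<ge> 0"
  using moduli_leD1[OF assms(1), of 0 0] moduli_leD2[OF assms(1), of 0 0] assms(2) by auto

lemma moduli_le_minus: "moduli_le (\<lambda>u. - g u) h W w \<longleftrightarrow> moduli_le g h W w"
proof -
  have "\<bar>- g s - - g t\<bar> = \<bar>g s - g t\<bar>"
    "\<bar>- g (t - s) - 2 * - g t + - g (t + s)\<bar> = \<bar>g (t - s) - 2 * g t + g (t + s)\<bar>" for s t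
    by (simp_all add: abs_if)
  then show ?thesis by (simp only: moduli_le_def)
qed

text \<open>On an interval of length h inside [0,1] all second differences are admissible, so g
  stays within w of its chord, and the chord changes by at most W. Longer distances are covered by
  steps of length h; each costs W, which the linear term absorbs, so w is paid only once.\<close>

lemma increment_le:
  fixes g :: "real \<Rightarrow> real"
  assumes cont: "continuous_on {0..1} g" and h: "0 < h" "h \<le> 1/2"
    and mod: "moduli_le g h W w"
    and yv: "0 \<le> y" "y \<le> v" "v \<le> 1"
  shows "g v - g y \<le> (v - y) / h * W + w"
proof -
  note diff1 = moduli_leD1[OF mod] and diff2 = moduli_leD2[OF mod]
  have near: "g v - g y \<le> (v - y) / h * W + w" if "0 \<le> y" "y \<le> v" "v \<le> 1" "v - y \<le> h" for y v
  proof -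
    have chord: "\<bar>((p + h - z) * g p + (z - p) * g (p + h)) / h - g z\<bar> \<le> w"
      if p: "0 \<le> p" "p + h \<le> 1" "p \<le> z" "z \<le> p + h" for p z
    proof -
      \<comment> \<open>The sign \<open>\<sigma>\<close> treats g and -g together, turning the
        one-sided chord estimate into a bound on the absolute value.\<close>
      have ineq: "\<sigma> * (((p + h - z) * g p + (z - p) * g (p + h)) / h - g z) \<le> w"
        if \<sigma>: "\<sigma> = 1 \<or> \<sigma> = -1" for \<sigma> :: real
      proof -
        have "\<sigma> * g (t - s) - 2 * (\<sigma> * g t) + \<sigma> * g (t + s) \<le> w"
          if "0 \<le> s" "p \<le> t - s" "t + s \<le> p + h" for t s
          using diff2[of s t] that p \<sigma> by auto
        then have "((p + h - z) * (\<sigma> * g p) + (z - p) * (\<sigma> * g (p + h))) / (p + h - p) - \<sigma> * g z \<le> w"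
          using p h by (intro chord_minus_le_const continuous_intros continuous_on_subset[OF cont]) auto
        also have "((p + h - z) * (\<sigma> * g p) + (z - p) * (\<sigma> * g (p + h))) / (p + h - p) - \<sigma> * g z
            = \<sigma> * (((p + h - z) * g p + (z - p) * g (p + h)) / h - g z)"
          using h by (simp add: field_simps)
        finally show ?thesis .
      qed
      show ?thesis using ineq[of 1] ineq[of "-1"] by auto
    qed
    define r where "r = (v - y) / h"
    have r: "r \<ge> 0" "r * h = v - y" using that h by (auto simp: r_def)
    have "g v - g y \<le> r * W + w"
    \<comment> \<open>The chord of length h starts at y if it fits. Otherwise it ends at v, and v -
      h is nonnegative because v >= y > 1 - h >= h.\<close>
    proof (cases "y + h \<le> 1")
      case True
      have "g (y + h) - g y \<le> W" using diff1[of "y + h" y] True that h by auto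
      then have "r * (g (y + h) - g y) \<le> r * W"
        using r by (intro mult_left_mono) auto
      moreover have "\<bar>r * (g (y + h) - g y) + g y - g v\<bar> \<le> w"
        using chord[of y v] True that h
        by (simp add: r_def field_simps)
      ultimately show ?thesis by (simp add: abs_le_iff)
    next
      case False
      have "g v - g (v - h) \<le> W" using diff1[of v "v - h"] False that h by auto
      then have "r * (g v - g (v - h)) \<le> r * W"
        using r by (intro mult_left_mono) auto
      moreover have "\<bar>g v - r * (g v - g (v - h)) - g y\<bar> \<le> w"
        using chord[of "v - h" y] False that h
        by (simp add: r_def field_simps)
      ultimately show ?thesis by (simp add: abs_le_iff)
    qed
    then show ?thesis by (simp only: r_def)
  qed
  have far: "g v - g y \<le> (v - y) / h * W + w"
    if "0 \<le> y" "y \<le> v" "v \<le> 1" "v - y \<le> real (Suc k) * h" for k y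
    using that
  proof (induction k arbitrary: y)
    case 0
    then show ?case using near[of y v] by simp
  next
    case (Suc k)
    show ?case
    proof (cases "v - y \<le> h")
      case True
      then show ?thesis using near Suc by blast
    next
      case False
      have "g v - g (y + h) \<le> (v - (y + h)) / h * W + w"
        using Suc.prems False h by (intro Suc.IH) (auto simp: algebra_simps)
      moreover have "g (y + h) - g y \<le> W" using diff1[of "y + h" y] Suc.prems False h by auto
      moreover have "(v - (y + h)) / h * W = (v - y) / h * W - W" using h by (simp add: field_simps)
      ultimately show ?thesis by linarith
    qed
  qed
  obtain k where "(v - y) / h \<le> real k" using real_arch_simple by blast
  then have "v - y \<le> real (Suc k) * h" using h by (simp add: field_simps)
  then show ?thesis using far yv by blast
qed

text \<open>
  The admissible slopes \<open>c\<close> form an intersection of half-lines, one for each \<open>u\<close>. Opposite half-lines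
  meet by \<open>chord_minus_le\<close>, and each of them meets \<open>[- W / h, W / h]\<close> by \<open>increment_le\<close>.
\<close>

lemma quadratic_majorant:
  fixes g :: "real \<Rightarrow> real"
  assumes cont: "continuous_on {0..1} g" and h: "0 < h" "h \<le> 1/2"
    and mod: "moduli_le g h W w"
    and x: "x \<in> {0..1}"
  obtains c where "\<bar>c\<bar> \<le> W / h"
    and "\<And>u. u \<in> {0..1} \<Longrightarrow> g u - g x \<le> c * (u - x) + w * (1 + (u - x)\<^sup>2 / (2 * h\<^sup>2))"
proof -
  have W: "W \<ge> 0" and w: "w \<ge> 0" using moduli_le_nonneg[OF mod] h by auto
  define Q where "Q u = w * (1 + (u - x)\<^sup>2 / (2 * h\<^sup>2))" for u
  have Qw: "Q u \<ge> w" for u using w h by (simp add: Q_def distrib_left)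
  define lo where "lo u = (g u - g x - Q u) / (u - x)" for u
  define up where "up u = (g x - g u + Q u) / (x - u)" for u
  \<comment> \<open>\<open>Sup S\<close> is the least slope that is at least
    \<open>- (W / h)\<close> and meets all demands from the right of x. The inserted element also
    keeps S nonempty when x = 1.\<close>
  define S where "S = insert (- (W / h)) (lo ` {x<..1})"
  have lo_W: "lo u \<le> W / h" if "u \<in> {x<..1}" for u
  proof -
    have "g u - g x \<le> (u - x) / h * W + w"
      using increment_le[OF cont h mod, of x u] that x by auto
    then have "g u - g x - Q u \<le> W / h * (u - x)" using Qw[of u] by (simp add: mult.commute)
    then show ?thesis using that by (simp add: lo_def divide_le_eq)
  qed
  have up_W: "- (W / h) \<le> up u" if "u \<in> {0..<x}" for u
  proof -
    have "(- g x) - (- g u) \<le> (x - u) / h * W + w"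
      using that x mod
      by (intro increment_le[of "\<lambda>u. - g u", OF _ h]) (auto simp: moduli_le_minus intro!: continuous_intros cont)
    then have "- (W / h) * (x - u) \<le> g x - g u + Q u" using Qw[of u] by (simp add: mult.commute)
    then show ?thesis using that by (simp add: up_def le_divide_eq)
  qed
  have lo_up: "lo u \<le> up v" if u: "u \<in> {x<..1}" and v: "v \<in> {0..<x}" for u v
  proof -
    have "((u - x) * g v + (x - v) * g u) / (u - v) - g x
        \<le> w * (1 + (x - v) * (u - x) / (2 * h\<^sup>2))"
    proof (rule chord_minus_le)
      show "continuous_on {v..u} g" using u v x by (intro continuous_on_subset[OF cont]) auto
      show "g (t - s) - 2 * g t + g (t + s) \<le> w"
        if "0 \<le> s" "s \<le> h" "v \<le> t - s" "t + s \<le> u" for t s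
        using moduli_leD2[OF mod, of s t] that u v by auto
    qed (use u v h in auto)
    then have "(u - x) * g v + (x - v) * g u - (u - v) * g x
        \<le> (u - v) * (w * (1 + (x - v) * (u - x) / (2 * h\<^sup>2)))"
      using u v by (simp add: field_simps)
    \<comment> \<open>The curvature of Q fits the chord bound exactly: \<open>(u - x) * (x - v)^2 +
      (x - v) * (u - x)^2 = (u - v) * (x - v) * (u - x)\<close>.\<close>
    also have "\<dots> = (u - x) * Q v + (x - v) * Q u"
      using h unfolding Q_def by (simp add: field_simps power2_eq_square)
    finally have "(x - v) * (g u - g x - Q u) \<le> (u - x) * (g x - g v + Q v)"
      by (simp add: algebra_simps)
    then show ?thesis using u v by (simp add: lo_def up_def field_simps)
  qed
  have bdd: "bdd_above S" using lo_W W h by (auto simp: S_def intro!: bdd_aboveI[of _ "W / h"])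
  define c where "c = Sup S"
  have c_ge: "s \<le> c" if "s \<in> S" for s using that bdd by (auto simp: c_def intro: cSup_upper)
  have c_le: "c \<le> b" if "\<And>s. s \<in> S \<Longrightarrow> s \<le> b" for b
    using that unfolding c_def by (intro cSup_least) (auto simp: S_def)
  show thesis
  proof
    have "W / h \<ge> 0" using W h by simp
    then have "c \<le> W / h" using lo_W by (intro c_le) (auto simp: S_def)
    moreover have "- (W / h) \<le> c" by (rule c_ge) (simp add: S_def)
    ultimately show "\<bar>c\<bar> \<le> W / h" by linarith
    fix u :: real assume u: "u \<in> {0..1}"
    consider "u = x" | "u \<in> {x<..1}" | "u \<in> {0..<x}" using u by force
    then have "g u - g x \<le> c * (u - x) + Q u"
    proof cases
      case 1
      then show ?thesis using Qw[of x] w by simp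
    next
      case 2
      then have "lo u \<le> c" by (intro c_ge) (simp add: S_def)
      then show ?thesis using 2 by (simp add: lo_def divide_le_eq)
    next
      case 3
      then have "c \<le> up u" using lo_up up_W by (intro c_le) (auto simp: S_def)
      then show ?thesis using 3 by (simp add: up_def le_divide_eq algebra_simps)
    qed
    then show "g u - g x \<le> c * (u - x) + w * (1 + (u - x)\<^sup>2 / (2 * h\<^sup>2))" by (simp add: Q_def)
  qed
qed

section \<open>Binomial moments\<close>

text \<open>For x in [0,1] this is the expectation of \<open>\<phi>\<close> under the binomial
  distribution with n trials and success probability x. The moment formulas are polynomial
  identities valid for every real x; only \<open>bmean_mono\<close> uses positivity.\<close>

definition bmean :: "nat \<Rightarrow> real \<Rightarrow> (nat \<Rightarrow> real) \<Rightarrow> real" where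
  "bmean n x \<phi> = (\<Sum>k\<le>n. Bernstein n k x * \<phi> k)"

lemma bmean_add: "bmean n x (\<lambda>k. \<phi> k + \<psi> k) = bmean n x \<phi> + bmean n x \<psi>"
  and bmean_diff: "bmean n x (\<lambda>k. \<phi> k - \<psi> k) = bmean n x \<phi> - bmean n x \<psi>"
  and bmean_cmult: "bmean n x (\<lambda>k. c * \<phi> k) = c * bmean n x \<phi>"
  by (simp_all add: bmean_def sum.distrib sum_subtractf sum_distrib_left algebra_simps)

lemma bmean_const: "bmean n x (\<lambda>_. c) = c"
  using sum_Bernstein[of n x] by (simp add: bmean_def flip: sum_distrib_right)

lemma bmean_mono:
  assumes "x \<in> {0..1}" "\<And>k. k \<le> n \<Longrightarrow> \<phi> k \<le> \<psi> k"
  shows "bmean n x \<phi> \<le> bmean n x \<psi>"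
  using assms unfolding bmean_def by (intro sum_mono mult_left_mono) (auto simp: Bernstein_nonneg)

text \<open>Pascal's rule. The truncated subtraction \<open>n - Suc k\<close> makes
  \<open>k \<ge> n\<close> a separate case.\<close>

lemma Bernstein_Suc_Suc:
  "Bernstein (Suc n) (Suc k) x = x * Bernstein n k x + (1 - x) * Bernstein n (Suc k) x"
proof (cases "k < n")
  case True
  then have "n - k = Suc (n - Suc k)" by simp
  then show ?thesis by (simp add: Bernstein_def algebra_simps)
next
  case False
  then have "n < k \<or> n = k" by auto
  then show ?thesis by (auto simp: Bernstein_def binomial_eq_0)
qed

text \<open>Conditioning on one trial: a success, with weight x, raises the count by one, and a
  failure leaves it unchanged.\<close>

lemma bmean_Suc:
  "bmean (Suc n) x \<phi> = x * bmean n x (\<lambda>k. \<phi> (Suc k)) + (1 - x) * bmean n x \<phi>"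
proof -
  have "bmean (Suc n) x \<phi> = Bernstein (Suc n) 0 x * \<phi> 0 + (\<Sum>k\<le>n. Bernstein (Suc n) (Suc k) x * \<phi> (Suc k))"
    by (simp only: bmean_def sum.atMost_Suc_shift)
  also have "\<dots> = x * bmean n x (\<lambda>k. \<phi> (Suc k))
      + (1 - x) * (Bernstein n 0 x * \<phi> 0 + (\<Sum>k\<le>n. Bernstein n (Suc k) x * \<phi> (Suc k)))"
    by (simp add: Bernstein_Suc_Suc bmean_def distrib_left distrib_right sum.distrib sum_distrib_left mult.assoc)
       (simp add: Bernstein_def)
  also have "Bernstein n 0 x * \<phi> 0 + (\<Sum>k\<le>n. Bernstein n (Suc k) x * \<phi> (Suc k))
      = (\<Sum>k\<le>Suc n. Bernstein n k x * \<phi> k)"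
    by (simp only: sum.atMost_Suc_shift)
  \<comment> \<open>The additional term \<open>k = Suc n\<close> vanishes with its binomial
    coefficient.\<close>
  also have "\<dots> = bmean n x \<phi>" by (simp add: bmean_def Bernstein_def)
  finally show ?thesis .
qed

lemma bmean_id: "bmean n x real = real n * x"
  using sum_k_Bernstein[of n x] by (simp add: bmean_def mult.commute)

text \<open>One more trial moves the centred count by 1 - x or by -x. Expanding the powers then
  gives each central moment by induction on n from the lower ones.\<close>

lemma bmean_central_Suc:
  "bmean (Suc n) x (\<lambda>k. (real k - real (Suc n) * x) ^ j)
    = x * bmean n x (\<lambda>k. ((real k - real n * x) + (1 - x)) ^ j)
      + (1 - x) * bmean n x (\<lambda>k. ((real k - real n * x) - x) ^ j)"
  by (simp add: bmean_Suc algebra_simps)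

lemma bmean_central1: "bmean n x (\<lambda>k. real k - real n * x) = 0"
  by (simp add: bmean_diff bmean_const bmean_id)

lemma bmean_central2: "bmean n x (\<lambda>k. (real k - real n * x)\<^sup>2) = real n * (x * (1 - x))"
proof (induction n)
  case 0
  show ?case by (simp add: bmean_def Bernstein_def)
next
  case (Suc n)
  have "(s + (1 - x))\<^sup>2 = s\<^sup>2 + 2 * (1 - x) * s + (1 - x)\<^sup>2" 
     "(s - x)\<^sup>2 = s\<^sup>2 - 2 * x * s + x\<^sup>2" for s :: real
    by (simp_all add: power2_eq_square algebra_simps)
  then show ?case
    unfolding bmean_central_Suc
    by (simp only: bmean_add bmean_diff bmean_cmult bmean_const bmean_id Suc bmean_central1)
       (simp add: power2_eq_square algebra_simps)
qed

lemma bmean_central3: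
  "bmean n x (\<lambda>k. (real k - real n * x) ^ 3) = real n * (x * (1 - x) * (1 - 2 * x))"
proof (induction n)
  case 0
  show ?case by (simp add: bmean_def Bernstein_def)
next
  case (Suc n)
  have "(s + (1 - x)) ^ 3 = s ^ 3 + 3 * (1 - x) * s\<^sup>2 + 3 * (1 - x)\<^sup>2 * s + (1 - x) ^ 3" 
     "(s - x) ^ 3 = s ^ 3 - 3 * x * s\<^sup>2 + 3 * x\<^sup>2 * s - x ^ 3" for s :: real
    by (simp_all add: power2_eq_square power3_eq_cube power4_eq_xxxx algebra_simps)
  then show ?case
    unfolding bmean_central_Suc
    by (simp only: bmean_add bmean_diff bmean_cmult bmean_const bmean_id Suc bmean_central1 bmean_central2 of_nat_Suc)
       (simp add: power2_eq_square power3_eq_cube algebra_simps)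
qed

lemma bmean_central4:
  "bmean n x (\<lambda>k. (real k - real n * x) ^ 4)
    = 3 * (real n)\<^sup>2 * (x * (1 - x))\<^sup>2 + real n * (x * (1 - x)) * (1 - 6 * (x * (1 - x)))"
proof (induction n)
  case 0
  show ?case by (simp add: bmean_def Bernstein_def)
next
  case (Suc n)
  have "(s + (1 - x)) ^ 4 = s ^ 4 + 4 * (1 - x) * s ^ 3 + 6 * (1 - x)\<^sup>2 * s\<^sup>2 + 4 * (1 - x) ^ 3 * s + (1 - x) ^ 4" 
     "(s - x) ^ 4 = s ^ 4 - 4 * x * s ^ 3 + 6 * x\<^sup>2 * s\<^sup>2 - 4 * x ^ 3 * s + x ^ 4" for s :: real
    by (simp_all add: power2_eq_square power3_eq_cube power4_eq_xxxx algebra_simps)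
  then show ?case
    unfolding bmean_central_Suc
    by (simp only: bmean_add bmean_diff bmean_cmult bmean_const bmean_id Suc bmean_central1 bmean_central2 bmean_central3 of_nat_Suc)
       (simp add: power2_eq_square power3_eq_cube power4_eq_xxxx algebra_simps)
qed

section \<open>The Kantorovich operator and its derivative\<close>

definition cell :: "nat \<Rightarrow> (real \<Rightarrow> real) \<Rightarrow> nat \<Rightarrow> real" where
  "cell n f k = integral {real k / (real n + 1)..(real k + 1) / (real n + 1)} f"

definition kant :: "nat \<Rightarrow> (real \<Rightarrow> real) \<Rightarrow> real \<Rightarrow> real" where
  "kant n f x = (real n + 1) * bmean n x (cell n f)"

text \<open>\<open>real n * kant_diff n f\<close> is the derivative of \<open>kant n f\<close>.\<close>

definition kant_diff :: "nat \<Rightarrow> (real \<Rightarrow> real) \<Rightarrow> real \<Rightarrow> real" where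
  "kant_diff n f x = (real n + 1) * bmean (n - 1) x (\<lambda>k. cell n f (Suc k) - cell n f k)"

lemma cell_minus: "cell n (\<lambda>u. - f u) = (\<lambda>k. - cell n f k)"
  by (simp add: cell_def fun_eq_iff)

lemma bmean_minus: "bmean n x (\<lambda>k. - \<phi> k) = - bmean n x \<phi>"
  using bmean_cmult[of n x "-1" \<phi>] by simp

lemma kant_minus: "kant n (\<lambda>u. - f u) x = - kant n f x"
  by (simp add: kant_def cell_minus bmean_minus)

lemma kant_diff_minus: "kant_diff n (\<lambda>u. - f u) x = - kant_diff n f x"
  by (simp add: kant_diff_def cell_minus bmean_diff bmean_minus algebra_simps)

lemma bernstein_basis_int: "bernstein_basis n (int k) x = Bernstein n k x"
  by (simp add: bernstein_basis_def Bernstein_def)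

text \<open>Under the normalisation the two weights differ from the weights 1 - x and x of
  \<open>bmean_Suc\<close> by opposite multiples of 1 - 2x. The unperturbed weights reproduce
  \<open>kant\<close>; the perturbation multiplies the differences of adjacent cells.\<close>

lemma mod_kantorovich_eq:
  assumes "n \<ge> 1" "2 * a0 n + a1 n = 1"
  shows "mod_kantorovich a0 a1 n f x
    = kant n f x + (a1 n + 1) / 2 * (1 - 2 * x) * kant_diff n f x"
proof -
  obtain m where m: "n = Suc m" using assms(1) by (cases n) auto
  define J where "J = cell n f"
  \<comment> \<open>Each of the two sums over \<open>k \<le> Suc m\<close> has one vanishing end
    term: \<open>k = Suc m\<close> in A, and the index -1 in B.\<close>
  have neg1: "bernstein_basis m (-1) x = 0" by (simp add: bernstein_basis_def)
  have A: "(\<Sum>k\<le>Suc m. bernstein_basis m (int k) x * J k) = bmean m x J"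
    by (simp add: bernstein_basis_int bmean_def Bernstein_def)
  have B: "(\<Sum>k\<le>Suc m. bernstein_basis m (int k - 1) x * J k) = bmean m x (\<lambda>k. J (Suc k))"
    unfolding sum.atMost_Suc_shift by (simp add: bernstein_basis_int bmean_def neg1)
  have "mod_kantorovich a0 a1 n f x = (real n + 1) * (\<Sum>k\<le>n. mod_basis a0 a1 n k x * J k)"
    by (simp add: mod_kantorovich_def J_def cell_def atMost_atLeast0)
  also have "(\<Sum>k\<le>n. mod_basis a0 a1 n k x * J k)
      = mod_coeff a0 a1 x n * bmean m x J
        + mod_coeff a0 a1 (1 - x) n * bmean m x (\<lambda>k. J (Suc k))"
    unfolding A[symmetric] B[symmetric] sum_distrib_left sum.distrib[symmetric] m
    by (intro sum.cong) (simp_all add: mod_basis_def algebra_simps)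
  finally have eq: "mod_kantorovich a0 a1 n f x = (real n + 1)
      * (mod_coeff a0 a1 x n * bmean m x J + mod_coeff a0 a1 (1 - x) n * bmean m x (\<lambda>k. J (Suc k)))" .
  have "mod_coeff a0 a1 x n = 1 - x - (a1 n + 1) / 2 * (1 - 2 * x)"
    "mod_coeff a0 a1 (1 - x) n = x + (a1 n + 1) / 2 * (1 - 2 * x)"
    using assms(2) by (simp_all add: mod_coeff_def field_simps)
  then show ?thesis
    unfolding eq kant_def kant_diff_def
    by (simp only: m bmean_Suc bmean_diff J_def diff_Suc_1) (simp add: field_simps)
qed

lemma cell_subset: "k \<le> n \<Longrightarrow> {real k / (real n + 1)..(real k + 1) / (real n + 1)} \<subseteq> {0..1}"
  by (auto simp: divide_simps intro: order_trans[of _ "(real k + 1) / (real n + 1)"]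
      order_trans[of _ "real k / (real n + 1)"] elim!: order_trans)

lemma integral_from_antiderivative:
  fixes P Q :: "real \<Rightarrow> real"
  assumes "\<And>u. (Q has_real_derivative P u) (at u)" "a \<le> b"
  shows "(P has_integral (Q b - Q a)) {a..b}"
  using assms
  by (intro fundamental_theorem_of_calculus)
     (auto simp flip: has_real_derivative_iff_has_vector_derivative intro: has_field_derivative_at_within)

text \<open>Positivity of the operator. The antiderivative Q evaluates the cells of the majorant
  explicitly, so a polynomial Q leads to binomial moments.\<close>

lemma kant_le:
  assumes cont: "continuous_on {0..1} f" and x: "x \<in> {0..1}"
    and le: "\<And>u. u \<in> {0..1} \<Longrightarrow> f u \<le> P u"
    and Q: "\<And>u. (Q has_real_derivative P u) (at u)"
  shows "kant n f x \<le> bmean n x (\<lambda>k. (real n + 1)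
    * (Q ((real k + 1) / (real n + 1)) - Q (real k / (real n + 1))))"
  unfolding kant_def bmean_cmult[symmetric]
proof (intro bmean_mono[OF x] mult_left_mono)
  fix k assume k: "k \<le> n"
  have "f integrable_on {real k / (real n + 1)..(real k + 1) / (real n + 1)}"
    using cell_subset[OF k] cont continuous_on_subset by (blast intro: integrable_continuous_real)
  moreover have "(P has_integral (Q ((real k + 1) / (real n + 1)) - Q (real k / (real n + 1))))
      {real k / (real n + 1)..(real k + 1) / (real n + 1)}"
    by (intro integral_from_antiderivative Q) (simp add: divide_right_mono)
  ultimately show "cell n f k \<le> Q ((real k + 1) / (real n + 1)) - Q (real k / (real n + 1))"
    unfolding cell_def using cell_subset[OF k] le by (intro has_integral_le[OF integrable_integral]) blast+
qed simp

text \<open>If f - P is nonincreasing, its integral over a cell is at most that over the preceding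
  cell of equal length; both are compared with its value at the common endpoint. The cell
  differences of P are second differences of Q.\<close>

lemma kant_diff_le:
  assumes cont: "continuous_on {0..1} f" and x: "x \<in> {0..1}" and n: "n \<ge> 1"
    and anti: "\<And>u v. 0 \<le> u \<Longrightarrow> u \<le> v \<Longrightarrow> v \<le> 1 \<Longrightarrow> f v - P v \<le> f u - P u"
    and Q: "\<And>u. (Q has_real_derivative P u) (at u)"
  shows "kant_diff n f x \<le> bmean (n - 1) x (\<lambda>k. (real n + 1)
    * (Q ((real k + 2) / (real n + 1)) - 2 * Q ((real k + 1) / (real n + 1)) + Q (real k / (real n + 1))))"
  unfolding kant_diff_def bmean_cmult[symmetric]
proof (intro bmean_mono[OF x] mult_left_mono)
  fix k assume k: "k \<le> n - 1"
  define N where "N = real n + 1"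
  define a b c where "a = real k / N" and "b = (real k + 1) / N" and "c = (real k + 2) / N"
  have N: "N > 0" by (simp add: N_def)
  have abc: "a \<le> b" "b \<le> c" "b - a = 1 / N" "c - b = 1 / N" "0 \<le> a" "c \<le> 1"
    using N k n by (auto simp: a_def b_def c_def divide_right_mono simp flip: diff_divide_distrib)
       (simp add: N_def divide_le_eq)
  define G where "G u = f u - P u" for u
  have intf: "f integrable_on {u..v}" if "0 \<le> u" "v \<le> 1" for u v
    using that by (intro integrable_continuous_real continuous_on_subset[OF cont]) auto
  have hG: "(G has_integral (integral {u..v} f - (Q v - Q u))) {u..v}" if "0 \<le> u" "u \<le> v" "v \<le> 1" for u v
    unfolding G_def using intf that
    by (intro has_integral_diff integral_from_antiderivative Q integrable_integral) auto
  have "integral {b..c} f - (Q c - Q b) \<le> G b * (c - b)"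
    using has_integral_le[OF hG[of b c] has_integral_const_real[of "G b" b c]] abc anti[of b]
    by (auto simp: G_def mult.commute)
  moreover have "G b * (b - a) \<le> integral {a..b} f - (Q b - Q a)"
    using has_integral_le[OF has_integral_const_real[of "G b" a b] hG[of a b]] abc anti[of _ b]
    by (auto simp: G_def mult.commute)
  moreover have "cell n f (Suc k) = integral {b..c} f" "cell n f k = integral {a..b} f"
    by (simp_all add: cell_def a_def b_def c_def N_def add.commute)
  ultimately show "cell n f (Suc k) - cell n f k
      \<le> Q ((real k + 2) / (real n + 1)) - 2 * Q ((real k + 1) / (real n + 1)) + Q (real k / (real n + 1))"
    using abc by (simp flip: N_def a_def b_def c_def)
qed simp

section \<open>Central moments of the operator and of its derivative\<close>

lemma kant_moment_aux:
  "bmean n x (\<lambda>k. (real n + 1) * (((real k + 1) / (real n + 1) - x) ^ j - (real k / (real n + 1) - x) ^ j))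
    = (real n + 1) / (real n + 1) ^ j
      * bmean n x (\<lambda>k. ((real k - real n * x) + (1 - x)) ^ j - ((real k - real n * x) - x) ^ j)"
proof -
  have "(real k + 1) / (real n + 1) - x = ((real k - real n * x) + (1 - x)) / (real n + 1)"
    "real k / (real n + 1) - x = ((real k - real n * x) - x) / (real n + 1)" for k
    by (simp_all add: field_simps)
  then show ?thesis
    by (simp only: power_divide bmean_cmult[symmetric]) (simp add: diff_divide_distrib right_diff_distrib)
qed

text \<open>\<open>M j\<close> is j times the operator applied to the power (u - x)^(j-1), evaluated
  at x: integrating over a cell turns the power into a difference of j-th powers. The factor j is
  kept in front so that the central moment can be read off.\<close>

lemma kant_moment:
  fixes x :: real and n :: nat
  defines "N \<equiv> real n + 1" and "X \<equiv> x * (1 - x)"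
  defines "M \<equiv> (\<lambda>j. bmean n x (\<lambda>k. N * (((real k + 1) / N - x) ^ j - (real k / N - x) ^ j)))"
  shows "M 1 = 1"
    and "M 2 = (1 - 2 * x) / N"
    and "M 3 = 3 * ((real n - 1) * X + 1 / 3) / N\<^sup>2"
    and "M 4 = 4 * ((1 - 2 * x) * (5 * real n * X / 2 + (1 - 2 * X) / 4)) / N ^ 3"
    and "M 5 = 5 * (3 * (real n)\<^sup>2 * X\<^sup>2 + real n * X * (5 - 20 * X) + 1 / 5 - X + X\<^sup>2) / N ^ 4"
proof -
  have N: "N > 0" by (simp add: N_def)
  have M: "M j = N / N ^ j
      * bmean n x (\<lambda>k. ((real k - real n * x) + (1 - x)) ^ j - ((real k - real n * x) - x) ^ j)" for j
    unfolding M_def N_def by (rule kant_moment_aux)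
  have e1: "(s + (1 - x)) ^ 1 - (s - x) ^ 1 = 1" for s by simp
  have e2: "(s + (1 - x))\<^sup>2 - (s - x)\<^sup>2 = 2 * s + (1 - 2 * x)" for s
    by (simp add: power2_eq_square algebra_simps)
  have e3: "(s + (1 - x)) ^ 3 - (s - x) ^ 3 = 3 * s\<^sup>2 + 3 * (1 - 2 * x) * s + ((1 - x) ^ 3 + x ^ 3)" for s
    by (simp add: power2_eq_square power3_eq_cube algebra_simps)
  have e4: "(s + (1 - x)) ^ 4 - (s - x) ^ 4
      = 4 * s ^ 3 + 6 * (1 - 2 * x) * s\<^sup>2 + 4 * ((1 - x) ^ 3 + x ^ 3) * s + ((1 - x) ^ 4 - x ^ 4)" for s
    by (simp add: power2_eq_square power3_eq_cube power4_eq_xxxx algebra_simps)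
  have e5: "(s + (1 - x)) ^ 5 - (s - x) ^ 5
      = 5 * s ^ 4 + 10 * (1 - 2 * x) * s ^ 3 + 10 * ((1 - x) ^ 3 + x ^ 3) * s\<^sup>2
        + 5 * ((1 - x) ^ 4 - x ^ 4) * s + ((1 - x) ^ 5 + x ^ 5)" for s
    by (simp add: eval_nat_numeral algebra_simps)
  note lin = bmean_add bmean_cmult bmean_const bmean_central1 bmean_central2 bmean_central3 bmean_central4
  show "M 1 = 1"
    using N by (simp only: M e1 lin) simp
  show "M 2 = (1 - 2 * x) / N"
    using N by (simp only: M e2 lin) (simp add: power2_eq_square)
  have "bmean n x (\<lambda>k. ((real k - real n * x) + (1 - x)) ^ 3 - ((real k - real n * x) - x) ^ 3)
      = 3 * ((real n - 1) * X + 1 / 3)"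
    by (simp only: e3 lin) (simp add: X_def power3_eq_cube algebra_simps)
  then show "M 3 = 3 * ((real n - 1) * X + 1 / 3) / N\<^sup>2"
    using N by (simp only: M) (simp add: power2_eq_square power3_eq_cube)
  have "bmean n x (\<lambda>k. ((real k - real n * x) + (1 - x)) ^ 4 - ((real k - real n * x) - x) ^ 4)
      = 4 * ((1 - 2 * x) * (5 * real n * X / 2 + (1 - 2 * X) / 4))"
    by (simp only: e4 lin) (simp add: X_def power3_eq_cube power4_eq_xxxx field_simps)
  then show "M 4 = 4 * ((1 - 2 * x) * (5 * real n * X / 2 + (1 - 2 * X) / 4)) / N ^ 3"
    using N by (simp only: M) (simp add: power3_eq_cube power4_eq_xxxx)
  have "bmean n x (\<lambda>k. ((real k - real n * x) + (1 - x)) ^ 5 - ((real k - real n * x) - x) ^ 5)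
      = 5 * (3 * (real n)\<^sup>2 * X\<^sup>2 + real n * X * (5 - 20 * X) + 1 / 5 - X + X\<^sup>2)"
    by (simp only: e5 lin) (simp add: X_def eval_nat_numeral algebra_simps)
  then show "M 5 = 5 * (3 * (real n)\<^sup>2 * X\<^sup>2 + real n * X * (5 - 20 * X) + 1 / 5 - X + X\<^sup>2) / N ^ 4"
    using N by (simp only: M) (simp add: eval_nat_numeral)
qed

text \<open>Likewise \<open>M j\<close> is j times \<open>kant_diff\<close> of (u - x)^(j-1). The
  mean now runs over m = n - 1 trials, and N = m + 2 makes the centred count shift by multiples of x
  up to 2x.\<close>

lemma kant_diff_moment:
  fixes x :: real and n :: nat
  assumes n: "n \<ge> 1"
  defines "N \<equiv> real n + 1"
  defines "M \<equiv> (\<lambda>j. bmean (n - 1) x (\<lambda>k. N * (((real k + 2) / N - x) ^ j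
      - 2 * ((real k + 1) / N - x) ^ j + (real k / N - x) ^ j)))"
  shows "M 2 = 2 / N"
    and "M 3 = 6 * (1 - 2 * x) / N\<^sup>2"
    and "M 4 = 12 * ((real n - 1) * (x * (1 - x)) + (1 - 2 * x)\<^sup>2 + 1 / 6) / N ^ 3"
proof -
  obtain m where m: "n = Suc m" using n by (cases n) auto
  have N: "N = real m + 2" "N > 0" by (simp_all add: N_def m)
  have "(real k + 2) / N - x = ((real k - real m * x) + (2 - 2 * x)) / N"
    "(real k + 1) / N - x = ((real k - real m * x) + (1 - 2 * x)) / N"
    "real k / N - x = ((real k - real m * x) - 2 * x) / N" for k
    using N by (simp_all add: field_simps)
  then have M: "M j = N / N ^ j * bmean m x (\<lambda>k. ((real k - real m * x) + (2 - 2 * x)) ^ j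
      - 2 * ((real k - real m * x) + (1 - 2 * x)) ^ j + ((real k - real m * x) - 2 * x) ^ j)" for j
    unfolding M_def m
    by (simp only: power_divide bmean_cmult[symmetric])
       (simp add: diff_divide_distrib add_divide_distrib distrib_left right_diff_distrib)
  have e2: "(s + (2 - 2 * x))\<^sup>2 - 2 * (s + (1 - 2 * x))\<^sup>2 + (s - 2 * x)\<^sup>2 = 2" for s
    by (simp add: power2_eq_square algebra_simps)
  have e3: "(s + (2 - 2 * x)) ^ 3 - 2 * (s + (1 - 2 * x)) ^ 3 + (s - 2 * x) ^ 3
      = 6 * s + 6 * (1 - 2 * x)" for s
    by (simp add: power3_eq_cube algebra_simps)
  have e4: "(s + (2 - 2 * x)) ^ 4 - 2 * (s + (1 - 2 * x)) ^ 4 + (s - 2 * x) ^ 4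
      = 12 * s\<^sup>2 + 24 * (1 - 2 * x) * s + (12 * (1 - 2 * x)\<^sup>2 + 2)" for s
    by (simp add: power2_eq_square power4_eq_xxxx algebra_simps)
  note lin = bmean_add bmean_cmult bmean_const bmean_central1 bmean_central2
  show "M 2 = 2 / N"
    using N by (simp only: M e2 lin) (simp add: power2_eq_square)
  show "M 3 = 6 * (1 - 2 * x) / N\<^sup>2"
    using N by (simp only: M e3 lin) (simp add: power2_eq_square power3_eq_cube)
  have "bmean m x (\<lambda>k. ((real k - real m * x) + (2 - 2 * x)) ^ 4
      - 2 * ((real k - real m * x) + (1 - 2 * x)) ^ 4 + ((real k - real m * x) - 2 * x) ^ 4)
    = 12 * ((real n - 1) * (x * (1 - x)) + (1 - 2 * x)\<^sup>2 + 1 / 6)"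
    by (simp only: e4 lin) (simp add: m)
  then show "M 4 = 12 * ((real n - 1) * (x * (1 - x)) + (1 - 2 * x)\<^sup>2 + 1 / 6) / N ^ 3"
    using N by (simp only: M) (simp add: power3_eq_cube power4_eq_xxxx)
qed

section \<open>One-sided estimates\<close>

lemma nonpos_derivative_imp_le:
  fixes G G' :: "real \<Rightarrow> real"
  assumes der: "\<And>t. t \<in> S \<Longrightarrow> (G has_real_derivative G' t) (at t within S)"
    and sub: "{a..b} \<subseteq> S" and le: "a \<le> b"
    and nonpos: "\<And>t. t \<in> {a..b} \<Longrightarrow> G' t \<le> 0"
  shows "G b \<le> G a"
proof (cases "a < b")
  case True
  have "(G has_derivative (*) (G' t)) (at t within {a..b})" if "a \<le> t" "t \<le> b" for t
    using der[THEN DERIV_subset, OF _ sub] sub that unfolding has_field_derivative_def by auto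
  then obtain t where t: "t \<in> {a<..<b}" "G b - G a = G' t * (b - a)"
    using mvt_simple[OF True, of G "\<lambda>t. (*) (G' t)"] by blast
  then show ?thesis using nonpos[of t] mult_nonpos_nonneg[of "G' t" "b - a"] by auto
qed (use le in simp)

text \<open>P is the second antiderivative of the majorant of f'' that agrees with f in value and
  slope at x. Hence f - P is concave with a critical point of value 0 at x, which is its
  maximum.\<close>

lemma taylor2_majorant:
  fixes f f' f'' :: "real \<Rightarrow> real"
  assumes deriv1: "\<And>t. t \<in> {0..1} \<Longrightarrow> (f has_real_derivative f' t) (at t within {0..1})"
    and deriv2: "\<And>t. t \<in> {0..1} \<Longrightarrow> (f' has_real_derivative f'' t) (at t within {0..1})"
    and x: "x \<in> {0..1}"
    and maj: "\<And>u. u \<in> {0..1} \<Longrightarrow> f'' u - f'' x \<le> c * (u - x) + w * (1 + \<kappa> * (u - x)\<^sup>2)"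
    and u: "u \<in> {0..1}"
  shows "f u \<le> f x + f' x * (u - x) + f'' x * (u - x)\<^sup>2 / 2 + c * (u - x) ^ 3 / 6
    + w * ((u - x)\<^sup>2 / 2 + \<kappa> * (u - x) ^ 4 / 12)"
proof -
  define P where "P v = f x + f' x * (v - x) + f'' x * (v - x)\<^sup>2 / 2 + c * (v - x) ^ 3 / 6
    + w * ((v - x)\<^sup>2 / 2 + \<kappa> * (v - x) ^ 4 / 12)" for v
  define P' where "P' v = f' x + f'' x * (v - x) + c * (v - x)\<^sup>2 / 2
    + w * ((v - x) + \<kappa> * (v - x) ^ 3 / 3)" for v
  define P'' where "P'' v = f'' x + c * (v - x) + w * (1 + \<kappa> * (v - x)\<^sup>2)" for v
  have P: "(P has_real_derivative P' v) (at v within {0..1})" for v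
    unfolding P_def P'_def by (auto intro!: derivative_eq_intros simp: field_simps)
  have P': "(P' has_real_derivative P'' v) (at v within {0..1})" for v
    unfolding P'_def P''_def by (auto intro!: derivative_eq_intros simp: field_simps)
  define G G' where "G v = f v - P v" and "G' v = f' v - P' v" for v
  have dG: "(G has_real_derivative G' v) (at v within {0..1})" if "v \<in> {0..1}" for v
    unfolding G_def G'_def using that by (intro DERIV_diff deriv1 P)
  have dG': "(G' has_real_derivative (f'' v - P'' v)) (at v within {0..1})" if "v \<in> {0..1}" for v
    unfolding G'_def using that by (intro DERIV_diff deriv2 P')
  have anti: "G' v \<le> G' t" if "0 \<le> t" "t \<le> v" "v \<le> 1" for t v
  proof (rule nonpos_derivative_imp_le[OF dG'])
    show "f'' s - P'' s \<le> 0" if "s \<in> {t..v}" for s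
      using maj[of s] that \<open>0 \<le> t\<close> \<open>v \<le> 1\<close> by (simp add: P''_def)
  qed (use that in auto)
  have Gx: "G x = 0" "G' x = 0" by (simp_all add: G_def G'_def P_def P'_def)
  have "G u \<le> G x"
  proof (cases "x \<le> u")
    case True
    then show ?thesis using anti[of x] Gx x u
      by (intro nonpos_derivative_imp_le[OF dG]) auto
  next
    case False
    have dG_minus: "((\<lambda>v. - G v) has_real_derivative - G' v) (at v within {0..1})" if "v \<in> {0..1}" for v
      using dG[OF that] by (rule DERIV_minus)
    then have "- G x \<le> - G u" using False anti[of _ x] Gx x u
      by (intro nonpos_derivative_imp_le[OF dG_minus]) auto
    then show ?thesis by simp
  qed
  then show ?thesis by (simp add: Gx) (simp add: G_def P_def)
qed

text \<open>The Taylor majorant is integrated cell by cell. \<open>m2\<close>, \<open>m3\<close> and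
  \<open>m4\<close> are the second to fourth central moments, that is, the values in
  \<open>kant_moment\<close> divided by 3, 4 and 5.\<close>

lemma kant_upper:
  fixes f f' f'' :: "real \<Rightarrow> real" and n :: nat
  assumes deriv1: "\<And>t. t \<in> {0..1} \<Longrightarrow> (f has_real_derivative f' t) (at t within {0..1})"
    and deriv2: "\<And>t. t \<in> {0..1} \<Longrightarrow> (f' has_real_derivative f'' t) (at t within {0..1})"
    and x: "x \<in> {0..1}"
    and maj: "\<And>u. u \<in> {0..1} \<Longrightarrow> f'' u - f'' x \<le> c * (u - x) + w * (1 + \<kappa> * (u - x)\<^sup>2)"
  defines "N \<equiv> real n + 1" and "X \<equiv> x * (1 - x)"
  defines "m2 \<equiv> ((real n - 1) * X + 1 / 3) / N\<^sup>2"
    and "m3 \<equiv> (1 - 2 * x) * (5 * real n * X / 2 + (1 - 2 * X) / 4) / N ^ 3"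
    and "m4 \<equiv> (3 * (real n)\<^sup>2 * X\<^sup>2 + real n * X * (5 - 20 * X) + 1 / 5 - X + X\<^sup>2) / N ^ 4"
  shows "kant n f x \<le> f x + f' x * ((1 - 2 * x) / (2 * N)) + f'' x * m2 / 2 + c * m3 / 6
    + w * (m2 / 2 + \<kappa> * m4 / 12)"
proof -
  define Q where "Q u = f x * (u - x) ^ 1 + f' x / 2 * (u - x)\<^sup>2 + (f'' x + w) / 6 * (u - x) ^ 3
    + c / 24 * (u - x) ^ 4 + w * \<kappa> / 60 * (u - x) ^ 5" for u
  define M where "M j = bmean n x (\<lambda>k. N * (((real k + 1) / N - x) ^ j - (real k / N - x) ^ j))" for j
  have Q_diff: "N * (Q p - Q q) = f x * (N * ((p - x) ^ 1 - (q - x) ^ 1))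
      + f' x / 2 * (N * ((p - x)\<^sup>2 - (q - x)\<^sup>2)) + (f'' x + w) / 6 * (N * ((p - x) ^ 3 - (q - x) ^ 3))
      + c / 24 * (N * ((p - x) ^ 4 - (q - x) ^ 4)) + w * \<kappa> / 60 * (N * ((p - x) ^ 5 - (q - x) ^ 5))" for p q
    by (simp add: Q_def algebra_simps)
  have cont: "continuous_on {0..1} f"
    using deriv1 DERIV_continuous_on by blast
  have "kant n f x \<le> bmean n x (\<lambda>k. N * (Q ((real k + 1) / N) - Q (real k / N)))"
    unfolding N_def
  proof (rule kant_le[OF cont x taylor2_majorant[OF deriv1 deriv2 x maj]])
    show "(Q has_real_derivative f x + f' x * (u - x) + f'' x * (u - x)\<^sup>2 / 2 + c * (u - x) ^ 3 / 6
        + w * ((u - x)\<^sup>2 / 2 + \<kappa> * (u - x) ^ 4 / 12)) (at u)" for u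
      unfolding Q_def by (auto intro!: derivative_eq_intros simp: field_simps)
  qed
  also have "\<dots> = f x * M 1 + f' x / 2 * M 2 + (f'' x + w) / 6 * M 3 + c / 24 * M 4 + w * \<kappa> / 60 * M 5"
    by (simp only: Q_diff bmean_add bmean_cmult M_def)
  finally have le: "kant n f x \<le> f x * M 1 + f' x / 2 * M 2 + (f'' x + w) / 6 * M 3 + c / 24 * M 4
    + w * \<kappa> / 60 * M 5" .
  have M: "M 1 = 1" "M 2 = (1 - 2 * x) / N" "M 3 = 3 * m2" "M 4 = 4 * m3" "M 5 = 5 * m4"
    unfolding M_def N_def m2_def m3_def m4_def X_def
    by (simp_all only: kant_moment times_divide_eq_right)
  have "N > 0" by (simp add: N_def)
  then have "f x * 1 + f' x / 2 * ((1 - 2 * x) / N) + (f'' x + w) / 6 * (3 * m2) + c / 24 * (4 * m3)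
      + w * \<kappa> / 60 * (5 * m4)
    = f x + f' x * ((1 - 2 * x) / (2 * N)) + f'' x * m2 / 2 + c * m3 / 6 + w * (m2 / 2 + \<kappa> * m4 / 12)"
    by (simp add: field_simps)
  with le show ?thesis unfolding M by simp
qed

text \<open>An upper bound for f' makes f minus the antiderivative of that bound nonincreasing, so
  \<open>kant_diff_le\<close> applies. Taking c = w = 0 also gives the crude bound by the norm of
  f'.\<close>

lemma kant_diff_upper:
  fixes f f' :: "real \<Rightarrow> real" and n :: nat
  assumes deriv1: "\<And>t. t \<in> {0..1} \<Longrightarrow> (f has_real_derivative f' t) (at t within {0..1})"
    and x: "x \<in> {0..1}" and n: "n \<ge> 1"
    and maj: "\<And>u. u \<in> {0..1} \<Longrightarrow> f' u \<le> \<alpha> + c * (u - x) + w * (1 + \<kappa> * (u - x)\<^sup>2)"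
  defines "N \<equiv> real n + 1"
  shows "kant_diff n f x \<le> (\<alpha> + c * (1 - 2 * x) / N
    + w * (1 + \<kappa> * ((real n - 1) * (x * (1 - x)) + (1 - 2 * x)\<^sup>2 + 1 / 6) / N\<^sup>2)) / N"
proof -
  define P where "P u = (\<alpha> + w) * (u - x) + c / 2 * (u - x)\<^sup>2 + w * \<kappa> / 3 * (u - x) ^ 3" for u
  define Q where "Q u = (\<alpha> + w) / 2 * (u - x)\<^sup>2 + c / 6 * (u - x) ^ 3 + w * \<kappa> / 12 * (u - x) ^ 4" for u
  define M where "M j = bmean (n - 1) x (\<lambda>k. N * (((real k + 2) / N - x) ^ j
      - 2 * ((real k + 1) / N - x) ^ j + (real k / N - x) ^ j))" for j
  have Q_diff: "N * (Q p - 2 * Q r + Q q) = (\<alpha> + w) / 2 * (N * ((p - x)\<^sup>2 - 2 * (r - x)\<^sup>2 + (q - x)\<^sup>2))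
      + c / 6 * (N * ((p - x) ^ 3 - 2 * (r - x) ^ 3 + (q - x) ^ 3))
      + w * \<kappa> / 12 * (N * ((p - x) ^ 4 - 2 * (r - x) ^ 4 + (q - x) ^ 4))" for p q r
  proof -
    \<comment> \<open>With the powers treated as opaque, the identity is linear in them.\<close>
    define P2 P3 P4 where "P2 = (p - x)\<^sup>2" and "P3 = (p - x) ^ 3" and "P4 = (p - x) ^ 4"
    define R2 R3 R4 where "R2 = (r - x)\<^sup>2" and "R3 = (r - x) ^ 3" and "R4 = (r - x) ^ 4"
    show ?thesis
      unfolding Q_def P2_def[symmetric] P3_def[symmetric] P4_def[symmetric]
        R2_def[symmetric] R3_def[symmetric] R4_def[symmetric]
      by (simp add: algebra_simps)
  qed
  have cont: "continuous_on {0..1} f"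
    using deriv1 DERIV_continuous_on by blast
  have dP: "((\<lambda>u. f u - P u) has_real_derivative
      (f' u - (\<alpha> + c * (u - x) + w * (1 + \<kappa> * (u - x)\<^sup>2)))) (at u within {0..1})" if "u \<in> {0..1}" for u
    unfolding P_def using that
    by (auto intro!: derivative_eq_intros deriv1 simp: field_simps)
  have "kant_diff n f x \<le> bmean (n - 1) x (\<lambda>k. N
      * (Q ((real k + 2) / N) - 2 * Q ((real k + 1) / N) + Q (real k / N)))"
    unfolding N_def
  proof (rule kant_diff_le[OF cont x n])
    show "f v - P v \<le> f u - P u" if "0 \<le> u" "u \<le> v" "v \<le> 1" for u v
      using that maj by (intro nonpos_derivative_imp_le[OF dP]) auto
    show "(Q has_real_derivative P u) (at u)" for u
      unfolding Q_def P_def by (auto intro!: derivative_eq_intros simp: field_simps)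
  qed
  also have "\<dots> = (\<alpha> + w) / 2 * M 2 + c / 6 * M 3 + w * \<kappa> / 12 * M 4"
    by (simp only: Q_diff bmean_add bmean_cmult M_def)
  finally have le: "kant_diff n f x \<le> (\<alpha> + w) / 2 * M 2 + c / 6 * M 3 + w * \<kappa> / 12 * M 4" .
  have M: "M 2 = 2 / N" "M 3 = 6 * (1 - 2 * x) / N\<^sup>2"
    "M 4 = 12 * ((real n - 1) * (x * (1 - x)) + (1 - 2 * x)\<^sup>2 + 1 / 6) / N ^ 3"
    unfolding M_def N_def by (simp_all only: kant_diff_moment[OF n])
  have "N > 0" by (simp add: N_def)
  define T where "T = (real n - 1) * (x * (1 - x)) + (1 - 2 * x)\<^sup>2 + 1 / 6"
  have "(\<alpha> + w) / 2 * (2 / N) + c / 6 * (6 * (1 - 2 * x) / N\<^sup>2) + w * \<kappa> / 12 * (12 * T / N ^ 3)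
      = (\<alpha> + c * (1 - 2 * x) / N + w * (1 + \<kappa> * T / N\<^sup>2)) / N"
    using \<open>N > 0\<close> by (simp add: power2_eq_square power3_eq_cube field_simps)
  with le show ?thesis unfolding M T_def by simp
qed

section \<open>Moduli as upper bounds and the choice of the step\<close>

text \<open>Continuity on a compact interval bounds g, so the sets are bounded above and their real
  suprema are genuine upper bounds.\<close>

lemma moduli_le_modulus:
  assumes cont: "continuous_on {0..1} g" and h: "h \<le> \<delta>"
  shows "moduli_le g h (modulus1 g \<delta>) (modulus2 g \<delta>)"
proof -
  have "bounded (g ` {0..1})"
    by (intro compact_imp_bounded compact_continuous_image cont) simp
  then obtain B where B: "\<bar>g u\<bar> \<le> B" if "u \<in> {0..1}" for u
    by (force simp: bounded_iff)
  have "bdd_above {\<bar>g s - g t\<bar> | s t. s \<in> {0..1} \<and> t \<in> {0..1} \<and> \<bar>s - t\<bar> \<le> \<delta>}"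
  proof (rule bdd_aboveI)
    fix y assume "y \<in> {\<bar>g s - g t\<bar> | s t. s \<in> {0..1} \<and> t \<in> {0..1} \<and> \<bar>s - t\<bar> \<le> \<delta>}"
    then obtain s t where "y = \<bar>g s - g t\<bar>" "s \<in> {0..1}" "t \<in> {0..1}" by blast
    then show "y \<le> 2 * B" using B[of s] B[of t] by linarith
  qed
  moreover have "bdd_above {\<bar>g (t - h) - 2 * g t + g (t + h)\<bar> | t h.
      0 \<le> h \<and> h \<le> \<delta> \<and> t - h \<in> {0..1} \<and> t + h \<in> {0..1}}"
  proof (rule bdd_aboveI)
    fix y assume "y \<in> {\<bar>g (t - h) - 2 * g t + g (t + h)\<bar> | t h.
      0 \<le> h \<and> h \<le> \<delta> \<and> t - h \<in> {0..1} \<and> t + h \<in> {0..1}}"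
    then obtain t h where "y = \<bar>g (t - h) - 2 * g t + g (t + h)\<bar>" "t - h \<in> {0..1}" "t \<in> {0..1}" "t + h \<in> {0..1}"
      by auto
    then show "y \<le> 4 * B" using B[of "t - h"] B[of t] B[of "t + h"] by linarith
  qed
  ultimately show ?thesis
    using h unfolding moduli_le_def modulus1_def modulus2_def
    by (intro conjI allI impI cSup_upper) force+
qed

lemma abs_le_sup_norm:
  assumes "continuous_on {0..1} g" "u \<in> {0..1}"
  shows "\<bar>g u\<bar> \<le> sup_norm g"
proof -
  have "bdd_above ((\<lambda>u. \<bar>g u\<bar>) ` {0..1})"
    using assms(1) by (intro bounded_imp_bdd_above compact_imp_bounded compact_continuous_image)
      (auto intro!: continuous_intros)
  then show ?thesis unfolding sup_norm_def using assms(2) by (intro cSUP_upper)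
qed

text \<open>The natural step is \<open>1 / sqrt (n + 1)\<close>, but the majorant needs a step of at most \<open>1 / 2\<close>.\<close>

lemma step_choice:
  fixes n :: nat
  assumes n: "n \<ge> 1"
  defines "N \<equiv> real n + 1"
  obtains h where "0 < h" "h \<le> 1 / 2" "h \<le> 1 / sqrt N" "1 / h \<le> 2 * sqrt N" "1 / h\<^sup>2 \<le> 2 * N"
    and "real n / N\<^sup>2 * (1 / h) \<le> 1 / sqrt N"
    and "real n / N * (1 + 1 / (2 * h\<^sup>2) * (real n / 4 + 7 / 6) / N\<^sup>2) \<le> 9 / 8"
proof -
  \<comment> \<open>Only n = 1 and n = 2 give 1 / sqrt N > 1/2; there h = 1/2 is taken.\<close>
  consider "n = 1" | "n = 2" | "n \<ge> 3" using n by linarith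
  then show thesis
  proof cases
    case 1
    have "sqrt 2 \<le> 2" by (rule real_le_lsqrt) auto
    moreover have "1 \<le> sqrt 2" by simp
    ultimately show thesis
      by (intro that[of "1/2"]) (auto simp: N_def 1 field_simps power2_eq_square)
  next
    case 2
    have "sqrt 3 \<le> 2" by (rule real_le_lsqrt) auto
    moreover have "1 \<le> sqrt 3" by simp
    ultimately show thesis
      by (intro that[of "1/2"]) (auto simp: N_def 2 field_simps power2_eq_square)
  next
    case 3
    define s where "s = sqrt N"
    have s: "s * s = N" "s > 0" using 3 by (auto simp: s_def N_def)
    have N: "N \<ge> 4" "N > 0" "real n = N - 1" using 3 by (auto simp: N_def)
    have s2: "2 \<le> s" unfolding s_def using N by (intro real_le_rsqrt) auto
    have s': "s\<^sup>2 = N" using s by (simp add: power2_eq_square)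
    show thesis
    proof (rule that[of "1 / s", folded s_def])
      have "real n / N\<^sup>2 * (1 / (1 / s)) = real n / N * (1 / s)"
        using s N by (simp add: power2_eq_square field_simps)
      also have "\<dots> \<le> 1 * (1 / s)" using s N by (intro mult_right_mono) auto
      finally show "real n / N\<^sup>2 * (1 / (1 / s)) \<le> 1 / s" by simp
      have "real n / N * (1 + 1 / (2 * (1 / s)\<^sup>2) * (real n / 4 + 7 / 6) / N\<^sup>2)
          = real n * (2 * N + (real n / 4 + 7 / 6)) / (2 * N\<^sup>2)"
        using N s by (simp add: power_divide s') (simp add: power2_eq_square field_simps)
      \<comment> \<open>With n = N - 1, four times the numerator is 9 N^2 - 16 N / 3 - 11/3, so 9/8
        is the limit value and is approached from below.\<close>
      also have "\<dots> \<le> 9 / 8"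
        using N by (simp add: divide_simps) (simp add: power2_eq_square algebra_simps)
      finally show "real n / N * (1 + 1 / (2 * (1 / s)\<^sup>2) * (real n / 4 + 7 / 6) / N\<^sup>2) \<le> 9 / 8" .
    qed (use s s2 s' N in \<open>auto simp: power_divide field_simps\<close>)
  qed
qed

lemma unit_interval_product:
  fixes x :: real
  assumes "x \<in> {0..1}"
  shows "0 \<le> x * (1 - x)" "x * (1 - x) \<le> 1 / 4" "\<bar>1 - 2 * x\<bar> \<le> 1" "(1 - 2 * x)\<^sup>2 = 1 - 4 * (x * (1 - x))"
proof -
  show "0 \<le> x * (1 - x)" using assms by simp
  show "x * (1 - x) \<le> 1 / 4"
    using zero_le_power2[of "1 - 2 * x"] by (simp add: power2_eq_square algebra_simps)
qed (use assms in \<open>auto simp: power2_eq_square algebra_simps\<close>)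

section \<open>Upper bounds for the two errors\<close>

lemma kant_diff_error_upper:
  fixes f f' :: "real \<Rightarrow> real" and n :: nat
  assumes deriv1: "\<And>t. t \<in> {0..1} \<Longrightarrow> (f has_real_derivative f' t) (at t within {0..1})"
    and cont: "continuous_on {0..1} f'"
    and x: "x \<in> {0..1}" and n: "n \<ge> 1" and F: "\<bar>f' x\<bar> \<le> F"
  defines "N \<equiv> real n + 1"
  assumes mod: "moduli_le f' (1 / sqrt N) W w"
  shows "real n * kant_diff n f x - f' x \<le> 1 / N * F + 1 / sqrt N * W + 9 / 8 * w"
proof -
  obtain h where h: "0 < h" "h \<le> 1 / 2" "h \<le> 1 / sqrt N" 
    and h1: "real n / N\<^sup>2 * (1 / h) \<le> 1 / sqrt N"
    and h2: "real n / N * (1 + 1 / (2 * h\<^sup>2) * (real n / 4 + 7 / 6) / N\<^sup>2) \<le> 9 / 8"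
    using step_choice[OF n] unfolding N_def by metis
  have modh: "moduli_le f' h W w" using mod h(3) unfolding moduli_le_def by (meson order_trans)
  have Ww: "W \<ge> 0" "w \<ge> 0" using moduli_le_nonneg[OF modh] h by auto
  have N: "N > 0" "real n = N - 1" by (simp_all add: N_def)
  note X = unit_interval_product[OF x]
  obtain c where c: "\<bar>c\<bar> \<le> W / h"
    "\<And>u. u \<in> {0..1} \<Longrightarrow> f' u - f' x \<le> c * (u - x) + w * (1 + (u - x)\<^sup>2 / (2 * h\<^sup>2))"
    by (rule quadratic_majorant[OF cont h(1,2) modh x]) blast
  define \<kappa> where "\<kappa> = 1 / (2 * h\<^sup>2)"
  define T where "T = (real n - 1) * (x * (1 - x)) + (1 - 2 * x)\<^sup>2 + 1 / 6"
  have "(real n - 1) * (x * (1 - x)) \<le> (real n - 1) * (1 / 4)"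
    using X n by (intro mult_left_mono) auto
  moreover have "(1 - 2 * x)\<^sup>2 \<le> 1" unfolding X(4) using X(1) by linarith
  ultimately have "T \<le> (real n - 1) * (1 / 4) + 1 + 1 / 6" unfolding T_def by (intro add_mono) auto
  then have T: "T \<le> real n / 4 + 7 / 6" by (simp add: field_simps)
  have "kant_diff n f x \<le> (f' x + c * (1 - 2 * x) / N + w * (1 + \<kappa> * T / N\<^sup>2)) / N"
    unfolding T_def N_def
  proof (rule kant_diff_upper[OF deriv1 x n])
    show "f' u \<le> f' x + c * (u - x) + w * (1 + \<kappa> * (u - x)\<^sup>2)" if "u \<in> {0..1}" for u
      using c(2)[OF that] by (simp add: \<kappa>_def)
  qed
  then have "real n * kant_diff n f x
      \<le> real n * ((f' x + c * (1 - 2 * x) / N + w * (1 + \<kappa> * T / N\<^sup>2)) / N)"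
    by (intro mult_left_mono) auto
  \<comment> \<open>Since n / N = 1 - 1 / N, the total mass of the derivative functional falls short
    of 1, which produces the norm term. The slope c yields the W term and the quadratic part the w
    term.\<close>
  also have "\<dots> = f' x + - f' x / N + real n / N\<^sup>2 * (c * (1 - 2 * x))
      + w * (real n / N * (1 + \<kappa> * T / N\<^sup>2))"
    unfolding N(2) using N(1) by (simp add: field_simps power2_eq_square)
  also have "- f' x / N \<le> 1 / N * F"
    using divide_right_mono[of "- f' x" F N] F N by (simp add: abs_le_iff)
  also have "real n / N\<^sup>2 * (c * (1 - 2 * x)) \<le> 1 / sqrt N * W"
  proof -
    have "c * (1 - 2 * x) \<le> \<bar>c\<bar> * \<bar>1 - 2 * x\<bar>" by (metis abs_ge_self abs_mult)
    also have "\<dots> \<le> W / h * 1" using c(1) X by (intro mult_mono) (auto intro: order_trans[OF abs_ge_zero])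
    finally have "real n / N\<^sup>2 * (c * (1 - 2 * x)) \<le> real n / N\<^sup>2 * (W / h * 1)"
      by (intro mult_left_mono) auto
    also have "\<dots> = real n / N\<^sup>2 * (1 / h) * W" by simp
    also have "\<dots> \<le> 1 / sqrt N * W" using h1 Ww by (intro mult_right_mono) auto
    finally show ?thesis .
  qed
  also have "w * (real n / N * (1 + \<kappa> * T / N\<^sup>2)) \<le> w * (9 / 8)"
  proof (rule mult_left_mono[OF _ Ww(2)])
    have "\<kappa> * T / N\<^sup>2 \<le> \<kappa> * (real n / 4 + 7 / 6) / N\<^sup>2"
      using T by (intro divide_right_mono mult_left_mono) (auto simp: \<kappa>_def)
    then have "real n / N * (1 + \<kappa> * T / N\<^sup>2) \<le> real n / N * (1 + \<kappa> * (real n / 4 + 7 / 6) / N\<^sup>2)"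
      using N by (intro mult_left_mono) auto
    also have "\<dots> \<le> 9 / 8" using h2 by (simp add: \<kappa>_def)
    finally show "real n / N * (1 + \<kappa> * T / N\<^sup>2) \<le> 9 / 8" .
  qed
  finally show ?thesis by simp
qed

lemma kant_voronovskaya_upper:
  fixes f f' f'' :: "real \<Rightarrow> real" and n :: nat
  assumes deriv1: "\<And>t. t \<in> {0..1} \<Longrightarrow> (f has_real_derivative f' t) (at t within {0..1})"
    and deriv2: "\<And>t. t \<in> {0..1} \<Longrightarrow> (f' has_real_derivative f'' t) (at t within {0..1})"
    and cont: "continuous_on {0..1} f''"
    and x: "x \<in> {0..1}" and n: "n \<ge> 1" and F: "\<bar>f' x\<bar> \<le> F1" "\<bar>f'' x\<bar> \<le> F2"
  defines "N \<equiv> real n + 1"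
  assumes mod: "moduli_le f'' (1 / sqrt N) W w"
  shows "real n * (kant n f x - f x) - x * (1 - x) / 2 * f'' x - (1 - 2 * x) / 2 * f' x
    \<le> 2 / (3 * N) * (3 / 4 * F1 + F2) + 9 / 32 * (2 / sqrt N * W + w)"
proof -
  obtain h where h: "0 < h" "h \<le> 1 / 2" "h \<le> 1 / sqrt N" 
    and h1: "1 / h \<le> 2 * sqrt N" and h2: "1 / h\<^sup>2 \<le> 2 * N"
    using step_choice[OF n] unfolding N_def by metis
  have modh: "moduli_le f'' h W w" using mod h(3) unfolding moduli_le_def by (meson order_trans)
  have Ww: "W \<ge> 0" "w \<ge> 0" using moduli_le_nonneg[OF modh] h by auto
  have N: "N \<ge> 2" "N > 0" "real n = N - 1" using n by (simp_all add: N_def)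
  define X X' where "X = x * (1 - x)" and "X' = 1 - 2 * x"
  note X = unit_interval_product[OF x, folded X_def X'_def]
  obtain c where c: "\<bar>c\<bar> \<le> W / h"
    "\<And>u. u \<in> {0..1} \<Longrightarrow> f'' u - f'' x \<le> c * (u - x) + w * (1 + (u - x)\<^sup>2 / (2 * h\<^sup>2))"
    by (rule quadratic_majorant[OF cont h(1,2) modh x]) blast
  define \<kappa> where "\<kappa> = 1 / (2 * h\<^sup>2)"
  have \<kappa>: "0 \<le> \<kappa>" "\<kappa> \<le> N" using h h2 by (auto simp: \<kappa>_def field_simps)
  define m2 where "m2 = ((real n - 1) * X + 1 / 3) / N\<^sup>2"
  define m3 where "m3 = X' * (5 * real n * X / 2 + (1 - 2 * X) / 4) / N ^ 3"
  define m4 where "m4 = (3 * (real n)\<^sup>2 * X\<^sup>2 + real n * X * (5 - 20 * X) + 1 / 5 - X + X\<^sup>2) / N ^ 4"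
  have "kant n f x \<le> f x + f' x * (X' / (2 * N)) + f'' x * m2 / 2 + c * m3 / 6
      + w * (m2 / 2 + \<kappa> * m4 / 12)"
    unfolding N_def X_def X'_def m2_def m3_def m4_def
  proof (rule kant_upper[OF deriv1 deriv2 x])
    show "f'' u - f'' x \<le> c * (u - x) + w * (1 + \<kappa> * (u - x)\<^sup>2)" if "u \<in> {0..1}" for u
      using c(2)[OF that] by (simp add: \<kappa>_def)
  qed
  then have "real n * (kant n f x - f x) \<le> real n * (f' x * (X' / (2 * N)) + f'' x * m2 / 2 + c * m3 / 6
      + w * (m2 / 2 + \<kappa> * m4 / 12))"
    by (intro mult_left_mono) auto
  \<comment> \<open>Writing n = N - 1 separates the limit from the remainders: n times the first
    moment misses X'/2 by X'/(2N), and n times the second moment misses X by O(1/N).\<close>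
  also have "\<dots> = X / 2 * f'' x + X' / 2 * f' x + - f' x * X' / (2 * N) + f'' x * ((real n * m2 - X) / 2)
      + c * (real n * m3 / 6) + w * (real n * m2 / 2 + \<kappa> * (real n * m4) / 12)"
    unfolding N(3) using N(2) by (simp add: field_simps)
  also have "- f' x * X' / (2 * N) \<le> F1 / (2 * N)"
  proof -
    have "- f' x * X' \<le> \<bar>f' x\<bar> * \<bar>X'\<bar>" by (metis abs_ge_self abs_mult abs_minus_cancel)
    also have "\<dots> \<le> F1 * 1" using F X by (intro mult_mono) auto
    finally show ?thesis using divide_right_mono[of "- f' x * X'" F1 "2 * N"] N by simp
  qed
  also have "f'' x * ((real n * m2 - X) / 2) \<le> F2 * (2 / (3 * N))"
  proof -
    have "real n * m2 - X = (real n / 3 - (3 * real n + 1) * X) / N\<^sup>2"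
    proof -
      have "real n * m2 - X = (real n * ((real n - 1) * X + 1 / 3) - X * N\<^sup>2) / N\<^sup>2"
        using N(2) by (simp add: m2_def diff_divide_distrib)
      also have "real n * ((real n - 1) * X + 1 / 3) - X * N\<^sup>2 = real n / 3 - (3 * real n + 1) * X"
        by (simp add: N_def power2_eq_square algebra_simps)
      finally show ?thesis .
    qed
    moreover have "\<bar>real n / 3 - (3 * real n + 1) * X\<bar> \<le> N"
    proof -
      define p where "p = (3 * real n + 1) * X"
      have "0 \<le> p" "p \<le> (3 * real n + 1) * (1 / 4)"
        unfolding p_def using X by (auto intro!: mult_left_mono mult_nonneg_nonneg)
      then show ?thesis unfolding p_def[symmetric] N_def by (simp add: abs_le_iff field_simps)
    qed
    ultimately have "\<bar>real n * m2 - X\<bar> \<le> N / N\<^sup>2" by (simp add: abs_divide divide_right_mono)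
    then have "\<bar>(real n * m2 - X) / 2\<bar> \<le> N / N\<^sup>2 / 2" by (simp add: abs_divide)
    also have "\<dots> \<le> 2 / (3 * N)" using N(2) by (simp add: power2_eq_square field_simps)
    finally have "\<bar>(real n * m2 - X) / 2\<bar> \<le> 2 / (3 * N)" .
    then have "\<bar>f'' x\<bar> * \<bar>(real n * m2 - X) / 2\<bar> \<le> F2 * (2 / (3 * N))" using F by (intro mult_mono) auto
    then show ?thesis by (metis abs_ge_self abs_mult order_trans)
  qed
  \<comment> \<open>The target 9/16 is 2 * 9/32. The moment bound 5/(48 N) and the slope bound 2
    sqrt N W give the smaller constant 5/24.\<close>
  also have "c * (real n * m3 / 6) \<le> 9 / 16 / sqrt N * W"
  proof -
    have pos: "0 \<le> 5 * real n * X / 2 + (1 - 2 * X) / 4" using X by auto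
    have "real n * X \<le> real n * (1 / 4)" using X by (intro mult_left_mono) auto
    moreover have "5 * real n * X / 2 = 5 / 2 * (real n * X)" by simp
    ultimately have le: "5 * real n * X / 2 + (1 - 2 * X) / 4 \<le> 5 / 8 * N"
      using X(1) unfolding N_def by argo
    have "\<bar>X' * (5 * real n * X / 2 + (1 - 2 * X) / 4)\<bar> \<le> 1 * (5 / 8 * N)"
      unfolding abs_mult using X pos le by (intro mult_mono) auto
    then have "\<bar>m3\<bar> * N ^ 3 \<le> 5 / 8 * N"
      using N(2) by (simp add: m3_def abs_divide)
    then have m3: "\<bar>m3\<bar> \<le> 5 / 8 * N / N ^ 3"
      using N(2) by (simp add: pos_le_divide_eq)
    have "\<bar>real n * m3 / 6\<bar> = real n * \<bar>m3\<bar> / 6" by (simp add: abs_mult)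
    also have "\<dots> \<le> N * (5 / 8 * N / N ^ 3) / 6"
      using N(2) m3 by (intro divide_right_mono mult_mono) (auto simp: N_def)
    also have "\<dots> = 5 / 48 / N" using N by (simp add: power3_eq_cube)
    finally have b: "\<bar>real n * m3 / 6\<bar> \<le> 5 / 48 / N" .
    have "W / h \<le> 2 * sqrt N * W" using mult_right_mono[OF h1 Ww(1)] by simp
    then have "\<bar>c\<bar> * \<bar>real n * m3 / 6\<bar> \<le> (2 * sqrt N * W) * (5 / 48 / N)"
      using b c(1) Ww N by (intro mult_mono) auto
    also have "\<dots> = 5 / 24 / sqrt N * W"
      using N by (simp add: field_simps)
    also have "\<dots> \<le> 9 / 16 / sqrt N * W"
      using N Ww by (intro mult_right_mono divide_right_mono) auto
    finally show ?thesis by (metis abs_ge_self abs_mult order_trans)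
  qed
  \<comment> \<open>The two summands are at most 1/8 and 1/12, and 5/24 < 9/32.\<close>
  also have "w * (real n * m2 / 2 + \<kappa> * (real n * m4) / 12) \<le> w * (9 / 32)"
  proof (rule mult_left_mono[OF _ Ww(2)])
    have "(real n - 1) * X \<le> (real n - 1) * (1 / 4)" using X n by (intro mult_left_mono) auto
    then have "m2 \<le> (N / 4) / N\<^sup>2" unfolding m2_def by (intro divide_right_mono) (auto simp: N_def)
    then have "real n * m2 / 2 \<le> N * ((N / 4) / N\<^sup>2) / 2"
      using N X n by (intro divide_right_mono mult_mono) (auto simp: m2_def)
    then have A: "real n * m2 / 2 \<le> 1 / 8" using N by (simp add: power2_eq_square)
    have "X * X \<le> 1 / 4 * (1 / 4)" using X by (intro mult_mono) auto
    then have XX: "X\<^sup>2 \<le> 1 / 16" by (simp add: power2_eq_square)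
    \<comment> \<open>The parabola has its maximum 5/16 at X = 1/8.\<close>
    have "X * (5 - 20 * X) \<le> 5 / 16" using zero_le_power2[of "X - 1/8"]
      by (simp add: power2_eq_square algebra_simps)
    then have "real n * (X * (5 - 20 * X)) \<le> real n * (5 / 16)" by (intro mult_left_mono) auto
    moreover have "3 * (real n)\<^sup>2 * X\<^sup>2 \<le> 3 * (real n)\<^sup>2 * (1 / 16)" using XX by (intro mult_left_mono) auto
    moreover have "1 / 5 - X + X\<^sup>2 \<le> 1 / 2" using X XX by linarith
    ultimately have "3 * (real n)\<^sup>2 * X\<^sup>2 + real n * (X * (5 - 20 * X)) + (1 / 5 - X + X\<^sup>2)
        \<le> 3 * (real n)\<^sup>2 * (1 / 16) + real n * (5 / 16) + 1 / 2"
      by (intro add_mono)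
    also have "\<dots> \<le> N\<^sup>2"
      unfolding N_def power2_sum by simp (use zero_le_power2[of "real n"] in linarith)
    finally have "m4 \<le> N\<^sup>2 / N ^ 4"
      unfolding m4_def by (intro divide_right_mono) (auto simp: mult.assoc)
    then have m4: "m4 \<le> 1 / N\<^sup>2" using N by (simp add: power2_eq_square power4_eq_xxxx)
    have "\<kappa> * (real n * m4) \<le> N * (N * (1 / N\<^sup>2))"
    \<comment> \<open>Multiplying the bounds for \<open>\<kappa>\<close> and \<open>m4\<close> uses
      \<open>m4 \<ge> 0\<close>; for negative \<open>m4\<close> the left side is at most 0.\<close>
    proof (cases "m4 \<ge> 0")
      case True
      then show ?thesis using \<kappa> N m4 by (intro mult_mono) auto
    next
      case False
      then have "\<kappa> * (real n * m4) \<le> 0" using \<kappa> by (simp add: mult_nonneg_nonpos)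
      also have "\<dots> \<le> N * (N * (1 / N\<^sup>2))" using N by simp
      finally show ?thesis .
    qed
    also have "\<dots> = 1" using N by (simp add: power2_eq_square)
    finally show "real n * m2 / 2 + \<kappa> * (real n * m4) / 12 \<le> 9 / 32" using A by linarith
  qed
  finally have "real n * (kant n f x - f x) - X / 2 * f'' x - X' / 2 * f' x
      \<le> F1 / (2 * N) + F2 * (2 / (3 * N)) + 9 / 16 / sqrt N * W + w * (9 / 32)"
    by linarith
  also have "\<dots> = 2 / (3 * N) * (3 / 4 * F1 + F2) + 9 / 32 * (2 / sqrt N * W + w)"
    by (simp add: distrib_left)
  finally show ?thesis by (simp only: X_def X'_def)
qed

section \<open>Assembly of the estimate\<close>

theorem theorem6p3:
  fixes a0 a1 :: "nat \<Rightarrow> real" and L1 :: real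
    and f f' f'' :: "real \<Rightarrow> real" and x :: real and n :: nat
  assumes normalized: "\<And>m. m \<ge> 1 \<Longrightarrow> 2 * a0 m + a1 m = 1"
    and lim: "a1 \<longlonglongrightarrow> L1"
    and deriv1: "\<And>t. t \<in> {0..1} \<Longrightarrow> (f has_real_derivative f' t) (at t within {0..1})"
    and deriv2: "\<And>t. t \<in> {0..1} \<Longrightarrow> (f' has_real_derivative f'' t) (at t within {0..1})"
    and cont2: "continuous_on {0..1} f''"
    and x: "x \<in> {0..1}"
    and n: "n \<ge> 1"
  shows "\<bar>real n * (mod_kantorovich a0 a1 n f x - f x)
            - x * (1 - x) / 2 * f'' x - (1 - 2 * x) / 2 * (2 + L1) * f' x\<bar>
         \<le> 2 / (3 * (real n + 1)) * (3 / 4 * sup_norm f' + sup_norm f'')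
           + 9 / 32 * (2 / sqrt (real n + 1) * modulus1 f'' (1 / sqrt (real n + 1))
                       + modulus2 f'' (1 / sqrt (real n + 1)))
           + 1 / 2 * \<bar>L1 - a1 n\<bar> * sup_norm f'
           + 1 / 2 * \<bar>L1 + 1\<bar> * (1 / (real n + 1) * sup_norm f'
                + 1 / sqrt (real n + 1) * modulus1 f' (1 / sqrt (real n + 1))
                + 9 / 8 * modulus2 f' (1 / sqrt (real n + 1)))"
proof -
  define \<delta> where "\<delta> = 1 / sqrt (real n + 1)"
  define K D X' where "K = kant n f x" and "D = kant_diff n f x" and "X' = 1 - 2 * x"
  define F1 F2 where "F1 = sup_norm f'" and "F2 = sup_norm f''"
  have cont1: "continuous_on {0..1} f'" using deriv2 DERIV_continuous_on by blast
  have F: "\<bar>f' u\<bar> \<le> F1" "\<bar>f'' u\<bar> \<le> F2" if "u \<in> {0..1}" for u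
    using abs_le_sup_norm cont1 cont2 that by (auto simp: F1_def F2_def)
  have X': "\<bar>X'\<bar> \<le> 1" using x by (auto simp: X'_def)
  note mod1 = moduli_le_modulus[OF cont1 order_refl] and mod2 = moduli_le_modulus[OF cont2 order_refl]
  have minus1: "((\<lambda>u. - f u) has_real_derivative - f' t) (at t within {0..1})" if "t \<in> {0..1}" for t
    using deriv1[OF that] by (rule DERIV_minus)
  have minus2: "((\<lambda>u. - f' u) has_real_derivative - f'' t) (at t within {0..1})" if "t \<in> {0..1}" for t
    using deriv2[OF that] by (rule DERIV_minus)

  define E1 where "E1 = real n * (K - f x) - x * (1 - x) / 2 * f'' x - X' / 2 * f' x"
  have "real n * (kant n (\<lambda>u. - f u) x - - f x) - x * (1 - x) / 2 * - f'' x - (1 - 2 * x) / 2 * - f' x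
    \<le> 2 / (3 * (real n + 1)) * (3 / 4 * F1 + F2) + 9 / 32 * (2 / sqrt (real n + 1) * modulus1 f'' \<delta> + modulus2 f'' \<delta>)"
    unfolding \<delta>_def
    by (rule kant_voronovskaya_upper[OF minus1 minus2 continuous_on_minus[OF cont2] x n])
       (use F[OF x] mod2 in \<open>auto simp: moduli_le_minus\<close>)
  moreover have "real n * (kant n (\<lambda>u. - f u) x - - f x) - x * (1 - x) / 2 * - f'' x - (1 - 2 * x) / 2 * - f' x = - E1"
    by (simp add: E1_def K_def X'_def kant_minus field_simps)
  moreover have "E1
    \<le> 2 / (3 * (real n + 1)) * (3 / 4 * F1 + F2) + 9 / 32 * (2 / sqrt (real n + 1) * modulus1 f'' \<delta> + modulus2 f'' \<delta>)"
    unfolding \<delta>_def E1_def X'_def K_def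
    by (rule kant_voronovskaya_upper[OF deriv1 deriv2 cont2 x n F[OF x] mod2])
  ultimately have E1: "\<bar>E1\<bar>
    \<le> 2 / (3 * (real n + 1)) * (3 / 4 * F1 + F2) + 9 / 32 * (2 / sqrt (real n + 1) * modulus1 f'' \<delta> + modulus2 f'' \<delta>)"
    by (simp only: abs_le_iff)

  define E2 where "E2 = real n * D - f' x"
  have "real n * kant_diff n (\<lambda>u. - f u) x - - f' x
    \<le> 1 / (real n + 1) * F1 + 1 / sqrt (real n + 1) * modulus1 f' \<delta> + 9 / 8 * modulus2 f' \<delta>"
    unfolding \<delta>_def
    by (rule kant_diff_error_upper[OF minus1 continuous_on_minus[OF cont1] x n])
       (use F[OF x] mod1 in \<open>auto simp: moduli_le_minus\<close>)
  moreover have "E2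
    \<le> 1 / (real n + 1) * F1 + 1 / sqrt (real n + 1) * modulus1 f' \<delta> + 9 / 8 * modulus2 f' \<delta>"
    unfolding \<delta>_def E2_def D_def
    by (rule kant_diff_error_upper[OF deriv1 cont1 x n F(1)[OF x] mod1])
  ultimately have E2: "\<bar>E2\<bar>
    \<le> 1 / (real n + 1) * F1 + 1 / sqrt (real n + 1) * modulus1 f' \<delta> + 9 / 8 * modulus2 f' \<delta>"
    unfolding abs_le_iff by (simp add: E2_def D_def kant_diff_minus)

  \<comment> \<open>The constant majorant F1 of f', with zero slope and zero curvature, bounds D for
    f and for -f.\<close>
  have "kant_diff n f x \<le> F1 / (real n + 1)"
    using kant_diff_upper[OF deriv1 x n, of F1 0 0] F by (auto simp: abs_le_iff)
  moreover have "kant_diff n (\<lambda>u. - f u) x \<le> F1 / (real n + 1)"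
    using kant_diff_upper[OF minus1 x n, of F1 0 0] F by (auto simp: abs_le_iff)
  ultimately have "\<bar>D\<bar> \<le> F1 / (real n + 1)"
    by (simp add: D_def kant_diff_minus abs_le_iff)
  then have "\<bar>real n * D\<bar> \<le> real n * (F1 / (real n + 1))"
    using mult_left_mono[of "\<bar>D\<bar>" "F1 / (real n + 1)" "real n"] by (simp add: abs_mult)
  also have "\<dots> \<le> F1"
    using F(1)[OF x] by (simp add: field_simps)
  finally have E3: "\<bar>real n * D\<bar> \<le> F1" .

  have eq: "mod_kantorovich a0 a1 n f x = K + (a1 n + 1) / 2 * X' * D"
    unfolding K_def D_def X'_def using n normalized[OF n] by (rule mod_kantorovich_eq)
  \<comment> \<open>The coefficient \<open>a1 n + 1\<close> is split into \<open>L1 + 1\<close> and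
    \<open>a1 n - L1\<close>. The deviation from the limit is paired with \<open>real n * D\<close>
    itself, so the crude bound E3 suffices for it, and E2 enters only with the factor
    \<open>L1 + 1\<close>.\<close>
  have "real n * (mod_kantorovich a0 a1 n f x - f x)
      - x * (1 - x) / 2 * f'' x - (1 - 2 * x) / 2 * (2 + L1) * f' x
    = E1 + X' * (1 / 2 * (a1 n - L1) * (real n * D)) + X' * (1 / 2 * (L1 + 1) * E2)"
    unfolding eq E1_def E2_def X'_def by (simp add: field_simps)
  also have "\<bar>\<dots>\<bar> \<le> \<bar>E1\<bar> + \<bar>X' * (1 / 2 * (a1 n - L1) * (real n * D))\<bar> + \<bar>X' * (1 / 2 * (L1 + 1) * E2)\<bar>"
    by linarith
  also have "\<bar>X' * (1 / 2 * (a1 n - L1) * (real n * D))\<bar> \<le> 1 * (1 / 2 * \<bar>L1 - a1 n\<bar> * F1)"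
    unfolding abs_mult[of X'] using X' E3
    by (intro mult_mono) (auto simp: abs_mult abs_minus_commute intro!: mult_left_mono)
  also have "\<bar>X' * (1 / 2 * (L1 + 1) * E2)\<bar> \<le> 1 * (1 / 2 * \<bar>L1 + 1\<bar>
      * (1 / (real n + 1) * F1 + 1 / sqrt (real n + 1) * modulus1 f' \<delta> + 9 / 8 * modulus2 f' \<delta>))"
    unfolding abs_mult[of X'] using X' E2
    by (intro mult_mono) (auto simp: abs_mult intro!: mult_left_mono)
  also note E1
  finally show ?thesis by (simp add: F1_def F2_def \<delta>_def)
qed

end
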